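(* Let $\varrho:\mathbb{R}\to\mathbb{R}$ be an activation function satisfying the Product Hypothesis, with fixed family $(\Pi^{\varrho}_{\varepsilon,K})_{\varepsilon,K>0}$. Let $n\in\mathbb{N}$, let $A,B\in\mathbb{R}^{n\times n}$ and let $K>0$ satisfy $|A|_\infty\le K$ and $|B|_\infty\le K$. Then, for every $\varepsilon>0$, the $\varrho$-MNN $\Phi^{\mathrm{STR}_{n,\varrho}}_{\varepsilon,K}$ (defined in the context) satisfies $$\left|R\left(\Phi^{\mathrm{STR}_{n,\varrho}}_{\varepsilon,K}\right)(A|B)-AB\right|_\infty\le\varepsilon,$$ $$M\left(\Phi^{\mathrm{STR}_{n,\varrho}}_{\varepsilon,K}\right)\le 7\,n^{\log_2 7}\left(M\left(\Pi^{\varrho}_{\frac{\varepsilon}{4n^2},\,2nK}\right)+12\right)-9n^2,$$ $$L\left(\Phi^{\mathrm{STR}_{n,\varrho}}_{\varepsilon,K}\right)\le L\left(\Pi^{\varrho}_{\frac{\varepsilon}{4n^2},\,2nK}\right)+2(\log_2 n+2).$$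
   Context: Notation. $|A|_\infty$ is the maximum absolute value of the entries of $A$. $A|B$ is the horizontal concatenation of matrices with equally many rows. For a matrix or tensor $T$, $\mathrm{n_W}(T)$ is its number of nonzero entries. A tensor $\mathcal{L}\in\mathbb{R}^{(n_1\times n_2)\times(n_3\times n_4)}$ acts on $A\in\mathbb{R}^{n_3\times n_4}$ by $(\mathcal{L}A)_{i,j}=\sum_{k,l}\mathcal{L}_{i,j,k,l}A_{k,l}$. For $A\in\mathbb{R}^{2^{k}\times 2^{k}}$, $k\ge1$, $A[1,1],A[1,2],A[2,1],A[2,2]\in\mathbb{R}^{2^{k-1}\times 2^{k-1}}$ are its upper-left, upper-right, lower-left and lower-right blocks. Matrix Neural Networks. A $\varrho$-MNN is a tuple $\Phi=((\mathcal{L}^1,C^1,\alpha^1),\dots,(\mathcal{L}^L,C^L,\alpha^L))$ where $\mathcal{L}^\ell$ is an $(N^{\ell,1}\times N^{\ell,2})\times(N^{\ell-1,1}\times N^{\ell-1,2})$ tensor, $C^\ell$ is an $N^{\ell,1}\times N^{\ell,2}$ matrix, and $\alpha^\ell$ acts entrywise on $N^{\ell,1}\times N^{\ell,2}$ matrices by functions $\alpha^\ell_{i,j}\in\{\mathrm{id},\varrho\}$ if $\ell<L$, while $\alpha^L=\mathrm{id}$. Its realization is $R(\Phi)(A)=A_L$, where $A_0=A$ and $A_\ell=\alpha^\ell(\mathcal{L}^\ell A_{\ell-1}+C^\ell)$. Its number of layers is $L(\Phi)=L$ and its number of weights is $M(\Phi)=\sum_{\ell=1}^{L}(\mathrm{n_W}(\mathcal{L}^\ell)+\mathrm{n_W}(C^\ell))$.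 The sparse concatenation $\Phi^1\odot\Phi^2$ is the tuple consisting of the layers of $\Phi^2$ followed by the layers of $\Phi^1$; thus $R(\Phi^1\odot\Phi^2)=R(\Phi^1)\circ R(\Phi^2)$, and $M$ and $L$ add up. The parallelization $\mathcal{P}(\Psi,\dots,\Psi)$ of copies of an MNN $\Psi$ is the MNN with $L(\Psi)$ layers that applies $\Psi$ layer by layer to each block of a vertically stacked input and stacks the outputs vertically; its number of weights is the sum of the numbers of weights of the copies. Product Hypothesis. For all $K,\varepsilon>0$ there is a $\varrho$-MNN $\Pi^{\varrho}_{\varepsilon,K}$ (with input a pair of scalars $(x,y)$, seen as a $1\times2$ matrix) such that $\sup_{(x,y)\in[-K,K]^2}|xy-R(\Pi^{\varrho}_{\varepsilon,K})(x,y)|\le\varepsilon$. One such network is fixed for each $\varepsilon,K$. Strassen networks for powers of 2. Set $\Phi^{\mathrm{STR}_{2^0,\varrho}}_{\varepsilon,K}=\Pi^{\varrho}_{\varepsilon,K}$ (so the realization at $A|B$ is $R(\Pi^\varrho_{\varepsilon,K})(A_{1,1},B_{1,1})$) and, for $k\ge1$, $$\Phi^{\mathrm{STR}_{2^k,\varrho}}_{\varepsilon,K}=\Phi^{\mathrm{MIX}_k}\odot\mathcal{P}\Big(\underbrace{\Phi^{\mathrm{STR}_{2^{k-1},\varrho}}_{\frac{\varepsilon}{4},2K},\dots,\Phi^{\mathrm{STR}_{2^{k-1},\varrho}}_{\frac{\varepsilon}{4},2K}}_{7}\Big)\odot\Phi^{\mathrm{SPLIT}_k},$$ where $\Phi^{\mathrm{MIX}_k}$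 and $\Phi^{\mathrm{SPLIT}_k}$ are the one-layer MNNs (linear maps, zero bias) with realizations: $\Phi^{\mathrm{MIX}_k}$ maps the vertical stack of $P_1,\dots,P_7\in\mathbb{R}^{2^{k-1}\times2^{k-1}}$ to $$\begin{pmatrix}P_1+P_4-P_5+P_7&P_3+P_5\\P_2+P_4&P_1-P_2+P_3+P_6\end{pmatrix},$$ and $\Phi^{\mathrm{SPLIT}_k}$ maps $A|B$ ($A,B\in\mathbb{R}^{2^k\times2^k}$) to the vertical stack of the seven blocks $(A[1,1]+A[2,2])\,|\,(B[1,1]+B[2,2])$; $(A[2,1]+A[2,2])\,|\,B[1,1]$; $A[1,1]\,|\,(B[1,2]-B[2,2])$; $A[2,2]\,|\,(B[2,1]-B[1,1])$; $(A[1,1]+A[1,2])\,|\,B[2,2]$; $(A[2,1]-A[1,1])\,|\,(B[1,1]+B[1,2])$; $(A[1,2]-A[2,2])\,|\,(B[2,1]+B[2,2])$. Strassen networks for square matrices of any size. For $n\in\mathbb{N}$ let $k=\lceil\log_2 n\rceil$ and $$\Phi^{\mathrm{STR}_{n,\varrho}}_{\varepsilon,K}=\Phi^{\mathrm{SHR}_n}_{n,n}\odot\Phi^{\mathrm{STR}_{2^k,\varrho}}_{\varepsilon,K}\odot\Phi^{\mathrm{EXT}^*}_n,$$ where $\Phi^{\mathrm{EXT}^*}_n$ is the one-layer MNN (zero bias) mapping $A|B$, $A,B\in\mathbb{R}^{n\times n}$, to $\begin{pmatrix}A&0\\0&0\end{pmatrix}\Big|\begin{pmatrix}B&0\\0&0\end{pmatrix}\in\mathbb{R}^{2^k\times2\cdot2^k}$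 (each block zero-padded to size $2^k\times2^k$), and $\Phi^{\mathrm{SHR}_n}_{n,n}$ is the one-layer MNN (zero bias) mapping a $2^k\times2^k$ matrix to its upper-left $n\times n$ submatrix.
   Formalization: The bound on M (resp. L) is stated for families in which the number of weights (resp. layers) of the product networks does not decrease as ε shrinks and K grows; for an arbitrary fixed family these bounds can fail, already for n = 1. *)

theory Defs
  imports Complex_Main "Jordan_Normal_Form.Matrix"
begin

section \<open>Matrix neural networks\<close>

text \<open>
  A tensor of shape \<open>(n1 \<times> n2) \<times> (n3 \<times> n4)\<close> is an \<open>n1 \<times> n2\<close> matrix whose entries are
  \<open>n3 \<times> n4\<close> matrices; its entry at \<open>i, j, k, l\<close> is \<open>T $$ (i,j) $$ (k,l)\<close>.
  All indices start at 0.
\<close>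

type_synonym tensor = "real mat mat"

definition tensor_carrier :: "nat \<times> nat \<Rightarrow> nat \<times> nat \<Rightarrow> tensor set" where
  "tensor_carrier = (\<lambda>(n1, n2) (n3, n4).
     {T \<in> carrier_mat n1 n2. \<forall>i<n1. \<forall>j<n2. T $$ (i,j) \<in> carrier_mat n3 n4})"

definition tensor_apply :: "tensor \<Rightarrow> real mat \<Rightarrow> real mat" where
  "tensor_apply T A = mat (dim_row T) (dim_col T) (\<lambda>(i,j).
     \<Sum>k<dim_row A. \<Sum>l<dim_col A. T $$ (i,j) $$ (k,l) * A $$ (k,l))"

definition nW_mat :: "real mat \<Rightarrow> nat" where
  "nW_mat C = card {(i,j). i < dim_row C \<and> j < dim_col C \<and> C $$ (i,j) \<noteq> 0}"

definition nW_tensor :: "tensor \<Rightarrow> nat" where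
  "nW_tensor T = card {(i,j,k,l). i < dim_row T \<and> j < dim_col T \<and>
     k < dim_row (T $$ (i,j)) \<and> l < dim_col (T $$ (i,j)) \<and> T $$ (i,j) $$ (k,l) \<noteq> 0}"

text \<open>The third component of a layer holds the entrywise activation functions.\<close>

type_synonym layer = "tensor \<times> real mat \<times> (real \<Rightarrow> real) mat"
type_synonym mnn = "layer list"

text \<open>
  \<open>is_mnn \<rho> d d' \<Phi>\<close>: \<open>\<Phi>\<close> is a \<open>\<rho>\<close>-MNN with input shape \<open>d\<close> and output shape \<open>d'\<close>.
  The layer \<open>\<Phi> ! s\<close> is number \<open>s + 1\<close> when counting from 1, and \<open>N s\<close> is the shape of the \<open>s\<close>-th
  intermediate matrix.
\<close>

definition is_mnn :: "(real \<Rightarrow> real) \<Rightarrow> nat \<times> nat \<Rightarrow> nat \<times> nat \<Rightarrow> mnn \<Rightarrow> bool" where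
  "is_mnn \<rho> d d' \<Phi> \<longleftrightarrow> \<Phi> \<noteq> [] \<and>
     (\<exists>N :: nat \<Rightarrow> nat \<times> nat. N 0 = d \<and> N (length \<Phi>) = d' \<and>
        (\<forall>s\<le>length \<Phi>. 0 < fst (N s) \<and> 0 < snd (N s)) \<and>
        (\<forall>s<length \<Phi>. case \<Phi> ! s of (T, C, \<alpha>) \<Rightarrow>
           T \<in> tensor_carrier (N (Suc s)) (N s) \<and>
           C \<in> carrier_mat (fst (N (Suc s))) (snd (N (Suc s))) \<and>
           \<alpha> \<in> carrier_mat (fst (N (Suc s))) (snd (N (Suc s))) \<and>
           elements_mat \<alpha> \<subseteq> (if Suc s < length \<Phi> then {id, \<rho>} else {id})))"

definition activate :: "(real \<Rightarrow> real) mat \<Rightarrow> real mat \<Rightarrow> real mat" where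
  "activate \<alpha> X = mat (dim_row X) (dim_col X) (\<lambda>(i,j). (\<alpha> $$ (i,j)) (X $$ (i,j)))"

fun realization :: "mnn \<Rightarrow> real mat \<Rightarrow> real mat" where
  "realization [] A = A"
| "realization ((T, C, \<alpha>) # \<Phi>) A = realization \<Phi> (activate \<alpha> (tensor_apply T A + C))"

definition num_layers :: "mnn \<Rightarrow> nat" where
  "num_layers \<Phi> = length \<Phi>"

definition num_weights :: "mnn \<Rightarrow> nat" where
  "num_weights \<Phi> = (\<Sum>(T, C, \<alpha>)\<leftarrow>\<Phi>. nW_tensor T + nW_mat C)"

definition sparse_concat :: "mnn \<Rightarrow> mnn \<Rightarrow> mnn" (infixr \<open>\<odot>\<close> 70) where
  "\<Phi>1 \<odot> \<Phi>2 = \<Phi>2 @ \<Phi>1"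

text \<open>
  Parallelization of \<open>m\<close> copies of the same network. Row \<open>i\<close> of a vertical stack of blocks of
  height \<open>h\<close> is row \<open>i mod h\<close> of block number \<open>i div h\<close>; the tensor is block diagonal.
\<close>

definition parallel_tensor :: "nat \<Rightarrow> tensor \<Rightarrow> tensor" where
  "parallel_tensor m T = mat (m * dim_row T) (dim_col T) (\<lambda>(i,j).
     let S = T $$ (i mod dim_row T, j) in
     mat (m * dim_row S) (dim_col S) (\<lambda>(k,l).
       if k div dim_row S = i div dim_row T then S $$ (k mod dim_row S, l) else 0))"

definition stack_copies :: "nat \<Rightarrow> 'a mat \<Rightarrow> 'a mat" where
  "stack_copies m C = mat (m * dim_row C) (dim_col C) (\<lambda>(i,j). C $$ (i mod dim_row C, j))"

definition parallel :: "nat \<Rightarrow> mnn \<Rightarrow> mnn" where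
  "parallel m = map (\<lambda>(T, C, \<alpha>). (parallel_tensor m T, stack_copies m C, stack_copies m \<alpha>))"

text \<open>
  The one-layer network with zero bias realizing a linear map \<open>f\<close> from \<open>n3 \<times> n4\<close> to \<open>n1 \<times> n2\<close>
  matrices. Its tensor is forced: \<open>T $$ (i,j) $$ (k,l)\<close> is the \<open>(i,j)\<close> entry of the image of the
  matrix unit at \<open>(k,l)\<close>.
\<close>

definition matrix_unit :: "nat \<times> nat \<Rightarrow> nat \<times> nat \<Rightarrow> real mat" where
  "matrix_unit d kl = mat (fst d) (snd d) (\<lambda>ij. if ij = kl then 1 else 0)"

definition linear_mnn :: "nat \<times> nat \<Rightarrow> nat \<times> nat \<Rightarrow> (real mat \<Rightarrow> real mat) \<Rightarrow> mnn" where
  "linear_mnn d d' f =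
     [(mat (fst d') (snd d') (\<lambda>ij. mat (fst d) (snd d) (\<lambda>kl. f (matrix_unit d kl) $$ ij)),
       0\<^sub>m (fst d') (snd d'),
       mat (fst d') (snd d') (\<lambda>_. id))]"

section \<open>Block operations\<close>

definition hcat :: "real mat \<Rightarrow> real mat \<Rightarrow> real mat" where
  "hcat A B = four_block_mat A B (0\<^sub>m 0 (dim_col A)) (0\<^sub>m 0 (dim_col B))"

definition halves :: "real mat \<Rightarrow> real mat \<times> real mat" where
  "halves X = (case split_block X (dim_row X) (dim_col X div 2) of (A, B, _, _) \<Rightarrow> (A, B))"

definition quarters :: "real mat \<Rightarrow> real mat \<times> real mat \<times> real mat \<times> real mat" where
  "quarters A = split_block A (dim_row A div 2) (dim_col A div 2)"

text \<open>
  Upper left \<open>r \<times> c\<close> block, and zero padding on the right and below to an \<open>m \<times> m\<close> matrix.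
\<close>

definition shrink :: "nat \<Rightarrow> nat \<Rightarrow> real mat \<Rightarrow> real mat" where
  "shrink r c A = mat r c (\<lambda>ij. A $$ ij)"

definition zero_pad :: "nat \<Rightarrow> real mat \<Rightarrow> real mat" where
  "zero_pad m A = four_block_mat A (0\<^sub>m (dim_row A) (m - dim_col A))
     (0\<^sub>m (m - dim_row A) (dim_col A)) (0\<^sub>m (m - dim_row A) (m - dim_col A))"

definition max_abs :: "real mat \<Rightarrow> real" where
  "max_abs A = Max (abs ` elements_mat A)"

section \<open>The product hypothesis\<close>

definition product_mnn :: "(real \<Rightarrow> real) \<Rightarrow> real \<Rightarrow> real \<Rightarrow> mnn \<Rightarrow> bool" where
  "product_mnn \<rho> \<epsilon> K \<Phi> \<longleftrightarrow> is_mnn \<rho> (1, 2) (1, 1) \<Phi> \<and>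
     (\<forall>x\<in>{-K..K}. \<forall>y\<in>{-K..K}.
        \<bar>x * y - realization \<Phi> (mat_of_rows_list 2 [[x, y]]) $$ (0,0)\<bar> \<le> \<epsilon>)"

definition product_hypothesis :: "(real \<Rightarrow> real) \<Rightarrow> bool" where
  "product_hypothesis \<rho> \<longleftrightarrow> (\<forall>K>0. \<forall>\<epsilon>>0. \<exists>\<Phi>. product_mnn \<rho> \<epsilon> K \<Phi>)"

definition product_family :: "(real \<Rightarrow> real) \<Rightarrow> (real \<Rightarrow> real \<Rightarrow> mnn) \<Rightarrow> bool" where
  "product_family \<rho> \<Psi> \<longleftrightarrow> (\<forall>K>0. \<forall>\<epsilon>>0. product_mnn \<rho> \<epsilon> K (\<Psi> \<epsilon> K))"

text \<open>
  A family of product networks has monotone cost if demanding more accuracy or a larger domain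
  never makes the networks cheaper. An arbitrary choice of product networks need not have this
  property, but \<open>monotone_product_family_exists\<close> below shows that it can always be arranged.
\<close>

definition monotone_cost :: "(mnn \<Rightarrow> nat) \<Rightarrow> (real \<Rightarrow> real \<Rightarrow> mnn) \<Rightarrow> bool" where
  "monotone_cost c \<Psi> \<longleftrightarrow> (\<forall>\<epsilon> \<epsilon>' K K'. 0 < \<epsilon>' \<longrightarrow> \<epsilon>' \<le> \<epsilon> \<longrightarrow> 0 < K \<longrightarrow> K \<le> K' \<longrightarrow>
     c (\<Psi> \<epsilon> K) \<le> c (\<Psi> \<epsilon>' K'))"

lemma nW_mat_zero: "nW_mat (0\<^sub>m r c) = 0"
proof -
  have "{(i,j). i < dim_row (0\<^sub>m r c :: real mat) \<and> j < dim_col (0\<^sub>m r c :: real mat) \<and>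
      (0\<^sub>m r c :: real mat) $$ (i,j) \<noteq> 0} = {}"
    by auto
  then show ?thesis unfolding nW_mat_def by (simp only: card.empty)
qed

lemma pad_identity_layers:
  assumes "is_mnn \<rho> (a, b) (1, 1) \<Phi>"
  shows "\<exists>\<Phi>'. is_mnn \<rho> (a, b) (1, 1) \<Phi>' \<and>
    (\<forall>A. realization \<Phi>' A $$ (0,0) = realization \<Phi> A $$ (0,0)) \<and>
    num_weights \<Phi>' = num_weights \<Phi> + t \<and> num_layers \<Phi>' = num_layers \<Phi> + t"
proof (induction t)
  case 0
  then show ?case using assms by auto
next
  case (Suc t)
  then obtain \<Phi>' where p: "is_mnn \<rho> (a, b) (1, 1) \<Phi>'"
    "\<And>A. realization \<Phi>' A $$ (0,0) = realization \<Phi> A $$ (0,0)"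
    "num_weights \<Phi>' = num_weights \<Phi> + t" "num_layers \<Phi>' = num_layers \<Phi> + t"
    by blast
  define I :: layer where "I = (mat 1 1 (\<lambda>_. mat 1 1 (\<lambda>_. 1)), 0\<^sub>m 1 1, mat 1 1 (\<lambda>_. id))"
  let ?F = "\<Phi>' @ [I]"
  obtain N where N: "N 0 = (a, b)" "N (length \<Phi>') = (1, 1)"
    "\<forall>s\<le>length \<Phi>'. 0 < fst (N s) \<and> 0 < snd (N s)"
    "\<forall>s<length \<Phi>'. case \<Phi>' ! s of (T, C, \<alpha>) \<Rightarrow>
       T \<in> tensor_carrier (N (Suc s)) (N s) \<and>
       C \<in> carrier_mat (fst (N (Suc s))) (snd (N (Suc s))) \<and>
       \<alpha> \<in> carrier_mat (fst (N (Suc s))) (snd (N (Suc s))) \<and>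
       elements_mat \<alpha> \<subseteq> (if Suc s < length \<Phi>' then {id, \<rho>} else {id})"
    and ne: "\<Phi>' \<noteq> []"
    using p(1) unfolding is_mnn_def by blast
  define N' where "N' = N(Suc (length \<Phi>') := (1, 1))"
  have wf: "is_mnn \<rho> (a, b) (1, 1) ?F"
    unfolding is_mnn_def
  proof (intro conjI exI[of _ N'] allI impI)
    fix s
    assume s: "s < length ?F"
    show "case ?F ! s of (T, C, \<alpha>) \<Rightarrow>
       T \<in> tensor_carrier (N' (Suc s)) (N' s) \<and>
       C \<in> carrier_mat (fst (N' (Suc s))) (snd (N' (Suc s))) \<and>
       \<alpha> \<in> carrier_mat (fst (N' (Suc s))) (snd (N' (Suc s))) \<and>
       elements_mat \<alpha> \<subseteq> (if Suc s < length ?F then {id, \<rho>} else {id})"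
    proof (cases "s = length \<Phi>'")
      case True
      then show ?thesis
        using N(2) by (auto simp: I_def N'_def tensor_carrier_def elements_mat_def)
    next
      case False
      then have l: "s < length \<Phi>'" using s by simp
      obtain T C \<alpha> where e: "\<Phi>' ! s = (T, C, \<alpha>)" by (metis prod_cases3)
      have "N' s = N s" "N' (Suc s) = N (Suc s)" using l by (auto simp: N'_def)
      then show ?thesis
        using N(4)[rule_format, OF l] l e by (auto simp: nth_append split: if_splits)
    qed
  next
    fix s
    assume "s \<le> length ?F"
    then show "0 < fst (N' s)" "0 < snd (N' s)"
      using N(3) by (auto simp: N'_def le_Suc_eq)
  qed (use N(1) in \<open>auto simp: N'_def\<close>)
  have tail: "realization (\<Phi> @ [I]) A = realization [I] (realization \<Phi> A)" for \<Phi> A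
    by (induction \<Phi> A rule: realization.induct) auto
  have dim: "dim_row (realization \<Phi>' A) = 1 \<and> dim_col (realization \<Phi>' A) = 1" for A
  proof -
    obtain \<Phi>0 T C \<alpha> where eq: "\<Phi>' = \<Phi>0 @ [(T, C, \<alpha>)]"
      using ne by (metis rev_exhaust prod_cases3)
    have "C \<in> carrier_mat 1 1"
      using N(4)[rule_format, of "length \<Phi>0"] N(2) by (simp add: eq)
    moreover have "realization (\<Phi>0 @ [(T, C, \<alpha>)]) A
        = realization [(T, C, \<alpha>)] (realization \<Phi>0 A)"
      by (induction \<Phi>0 A rule: realization.induct) auto
    ultimately show ?thesis by (auto simp: eq activate_def)
  qed
  have R: "\<forall>A. realization ?F A $$ (0,0) = realization \<Phi> A $$ (0,0)"
    unfolding tail using dim by (simp add: p(2) I_def activate_def tensor_apply_def)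
  have wt: "nW_tensor (fst I) = 1"
  proof -
    have "{(i,j,k,l). i < dim_row (fst I) \<and> j < dim_col (fst I) \<and>
      k < dim_row (fst I $$ (i,j)) \<and> l < dim_col (fst I $$ (i,j)) \<and> fst I $$ (i,j) $$ (k,l) \<noteq> 0}
      = {(0,0,0,0)}"
      by (auto simp: I_def)
    then show ?thesis by (simp add: nW_tensor_def)
  qed
  have wm: "nW_mat (fst (snd I)) = 0"
    by (simp only: I_def fst_conv snd_conv nW_mat_zero)
  have "num_weights ?F = num_weights \<Phi> + Suc t"
    using p(3) wt wm by (simp add: num_weights_def split_beta)
  moreover have "num_layers ?F = num_layers \<Phi> + Suc t"
    using p(4) by (simp add: num_layers_def)
  ultimately show ?case using wf R by blast
qed

theorem monotone_product_family_exists: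
  assumes "product_hypothesis \<rho>"
  shows "\<exists>\<Psi>. product_family \<rho> \<Psi> \<and> monotone_cost num_weights \<Psi> \<and> monotone_cost num_layers \<Psi>"
proof -
  have "\<exists>\<Phi>. product_mnn \<rho> (1 / real (Suc j)) (real (Suc j)) \<Phi>" for j
    using assms unfolding product_hypothesis_def by simp
  then obtain G where G: "\<And>j. product_mnn \<rho> (1 / real (Suc j)) (real (Suc j)) (G j)"
    by metis
  define t where "t j = (\<Sum>i<j. num_weights (G i) + num_layers (G i))" for j
  have "\<exists>\<Phi>. product_mnn \<rho> (1 / real (Suc j)) (real (Suc j)) \<Phi> \<and>
      num_weights \<Phi> = num_weights (G j) + t j \<and> num_layers \<Phi> = num_layers (G j) + t j" for j
    using G[of j] pad_identity_layers[of \<rho> 1 2 "G j" "t j"] unfolding product_mnn_def by metis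
  then obtain H where H: "\<And>j. product_mnn \<rho> (1 / real (Suc j)) (real (Suc j)) (H j)"
    and w: "\<And>j. num_weights (H j) = num_weights (G j) + t j"
    and l: "\<And>j. num_layers (H j) = num_layers (G j) + t j"
    by metis
  have mw: "mono (\<lambda>j. num_weights (H j))" and ml: "mono (\<lambda>j. num_layers (H j))"
    by (auto intro!: incseq_SucI simp: w l t_def)
  define J where "J \<epsilon> K = nat \<lceil>max (1 / \<epsilon>) K\<rceil>" for \<epsilon> K :: real
  define \<Psi> where "\<Psi> \<epsilon> K = H (J \<epsilon> K)" for \<epsilon> K
  have J: "J \<epsilon> K \<le> J \<epsilon>' K'" if "0 < \<epsilon>'" "\<epsilon>' \<le> \<epsilon>" "K \<le> K'" for \<epsilon> \<epsilon>' K K'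
  proof -
    have "1 / \<epsilon> \<le> 1 / \<epsilon>'" using that by (simp add: frac_le)
    then have "max (1 / \<epsilon>) K \<le> max (1 / \<epsilon>') K'" using that by linarith
    then show ?thesis unfolding J_def by (intro nat_mono ceiling_mono)
  qed
  have "product_mnn \<rho> \<epsilon> K (\<Psi> \<epsilon> K)" if "\<epsilon> > 0" "K > 0" for \<epsilon> K
  proof -
    have *: "max (1 / \<epsilon>) K \<le> real (Suc (J \<epsilon> K))"
      unfolding J_def by linarith
    then have "1 / \<epsilon> \<le> real (Suc (J \<epsilon> K))" by simp
    then have e: "1 / real (Suc (J \<epsilon> K)) \<le> \<epsilon>"
      using that by (simp add: field_simps)
    have "{-K..K} \<subseteq> {- real (Suc (J \<epsilon> K))..real (Suc (J \<epsilon> K))}"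
      using * by auto
    then show ?thesis
      using H[of "J \<epsilon> K"] e unfolding product_mnn_def \<Psi>_def by (meson order_trans subsetD)
  qed
  moreover have "monotone_cost num_weights \<Psi>" "monotone_cost num_layers \<Psi>"
    unfolding monotone_cost_def \<Psi>_def using J mw ml by (auto simp: mono_def)
  ultimately show ?thesis unfolding product_family_def by blast
qed

section \<open>Strassen networks\<close>

definition split_map :: "real mat \<Rightarrow> real mat" where
  "split_map X =
     (case halves X of (A, B) \<Rightarrow>
      case quarters A of (A11, A12, A21, A22) \<Rightarrow>
      case quarters B of (B11, B12, B21, B22) \<Rightarrow>
        hcat (A11 + A22) (B11 + B22) @\<^sub>r
        hcat (A21 + A22) B11 @\<^sub>r
        hcat A11 (B12 - B22) @\<^sub>r
        hcat A22 (B21 - B11) @\<^sub>r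
        hcat (A11 + A12) B22 @\<^sub>r
        hcat (A21 - A11) (B11 + B12) @\<^sub>r
        hcat (A12 - A22) (B21 + B22))"

definition mix_map :: "real mat \<Rightarrow> real mat" where
  "mix_map X =
     (let h = dim_col X;
          P = (\<lambda>p. mat h h (\<lambda>(i,j). X $$ ((p - 1) * h + i, j)))
      in four_block_mat (P 1 + P 4 - P 5 + P 7) (P 3 + P 5)
                        (P 2 + P 4) (P 1 - P 2 + P 3 + P 6))"

definition split_mnn :: "nat \<Rightarrow> mnn" where
  "split_mnn k = linear_mnn (2 ^ k, 2 * 2 ^ k) (7 * 2 ^ (k - 1), 2 * 2 ^ (k - 1)) split_map"

definition mix_mnn :: "nat \<Rightarrow> mnn" where
  "mix_mnn k = linear_mnn (7 * 2 ^ (k - 1), 2 ^ (k - 1)) (2 ^ k, 2 ^ k) mix_map"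

fun strassen_pow2 :: "(real \<Rightarrow> real \<Rightarrow> mnn) \<Rightarrow> nat \<Rightarrow> real \<Rightarrow> real \<Rightarrow> mnn" where
  "strassen_pow2 \<Psi> 0 \<epsilon> K = \<Psi> \<epsilon> K"
| "strassen_pow2 \<Psi> (Suc k) \<epsilon> K =
     mix_mnn (Suc k) \<odot> parallel 7 (strassen_pow2 \<Psi> k (\<epsilon> / 4) (2 * K)) \<odot> split_mnn (Suc k)"

definition ceil_log2 :: "nat \<Rightarrow> nat" where
  "ceil_log2 n = nat \<lceil>log 2 (real n)\<rceil>"

definition ext_mnn :: "nat \<Rightarrow> mnn" where
  "ext_mnn n = (let m = 2 ^ ceil_log2 n in
     linear_mnn (n, 2 * n) (m, 2 * m)
       (\<lambda>X. case halves X of (A, B) \<Rightarrow> hcat (zero_pad m A) (zero_pad m B)))"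

definition shr_mnn :: "nat \<Rightarrow> mnn" where
  "shr_mnn n = (let m = 2 ^ ceil_log2 n in linear_mnn (m, m) (n, n) (shrink n n))"

definition strassen :: "(real \<Rightarrow> real \<Rightarrow> mnn) \<Rightarrow> nat \<Rightarrow> real \<Rightarrow> real \<Rightarrow> mnn" where
  "strassen \<Psi> n \<epsilon> K = shr_mnn n \<odot> strassen_pow2 \<Psi> (ceil_log2 n) \<epsilon> K \<odot> ext_mnn n"

end

theory Submission
  imports Defs
begin

text \<open>
  The accuracy follows by induction on the exponent of the block size: all seven products are formed
  with error at most \<open>\<epsilon> / 4\<close> (their arguments are bounded by \<open>2 * K\<close>), and each block of the
  result is, by Strassen's identities, a signed sum of at most four of them. Splitting and mixing
  cost at most \<open>24 * 4 ^ k\<close> and \<open>12 * 4 ^ k\<close> weights, so that \<open>W k + 12 * 4 ^ k\<close> grows at most by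
  the factor 7 in each step. For general \<open>n\<close> one has \<open>n \<le> 2 ^ k \<le> 2 * n\<close>, whence
  \<open>7 ^ k \<le> 7 * n powr log 2 7\<close>.
\<close>

section \<open>Linear layers\<close>

text \<open>The recursion ends in product networks with parameters \<epsilon> / 4 ^ k and 2 ^ k * K,
  where k is the rounded-up logarithm of n, whereas the size bounds speak of the network for
  \<epsilon> / (4 * n ^ 2) and 2 * n * K. The second pair is at least as demanding, but a freely
  chosen family does not relate the sizes of its members at all. Hence \<open>monotone_cost\<close>
  appears in the weight and layer bounds and only there; shape and accuracy hold for every family.
  Split, mix, padding and cutting are given by their action on matrices, while realization and
  weight count are read off tensors. The link is to write each output entry as an explicit list of
  signed input entries: its values on matrix units are the tensor coefficients, and its length
  bounds how many of them are nonzero.\<close>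

text \<open>A term \<open>(s, k, l)\<close> stands for \<open>s\<close> times the entry at position \<open>(k, l)\<close>.\<close>

definition term_sum :: "(real \<times> nat \<times> nat) list \<Rightarrow> real mat \<Rightarrow> real" where
  "term_sum ts X = (\<Sum>(s, kl)\<leftarrow>ts. s * X $$ kl)"

lemma term_sum_simps [simp]:
  "term_sum [] X = 0"
  "term_sum ((s, kl) # ts) X = s * X $$ kl + term_sum ts X"
  by (simp_all add: term_sum_def)

text \<open>A linear functional is recovered from its values on matrix units, and these values are
  what \<open>linear_mnn\<close> stores. The positions have to lie inside the matrix, because
  entries outside it are unspecified and need not vanish on matrix units.\<close>

lemma sum_term_sum_matrix_unit:
  assumes "X \<in> carrier_mat r c" "\<And>s k l. (s, k, l) \<in> set ts \<Longrightarrow> k < r \<and> l < c"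
  shows "(\<Sum>k<r. \<Sum>l<c. term_sum ts (matrix_unit (r, c) (k, l)) * X $$ (k, l)) = term_sum ts X"
  using assms(2)
proof (induction ts)
  case Nil
  then show ?case by simp
next
  case (Cons t ts)
  obtain s a b where t: "t = (s, a, b)" by (cases t)
  with Cons.prems have ab: "a < r" "b < c" by auto
  have "(\<Sum>k<r. \<Sum>l<c. s * matrix_unit (r, c) (k, l) $$ (a, b) * X $$ (k, l))
      = (\<Sum>k<r. \<Sum>l<c. if k = a then if l = b then s * X $$ (k, l) else 0 else 0)"
    using ab by (intro sum.cong refl) (auto simp: matrix_unit_def)
  also have "\<dots> = (\<Sum>k<r. if k = a then (\<Sum>l<c. if l = b then s * X $$ (k, l) else 0) else 0)"
    by (intro sum.cong refl) auto
  also have "\<dots> = s * X $$ (a, b)"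
    using ab by simp
  finally have "(\<Sum>k<r. \<Sum>l<c. s * matrix_unit (r, c) (k, l) $$ (a, b) * X $$ (k, l))
      = s * X $$ (a, b)" .
  moreover have "(\<Sum>k<r. \<Sum>l<c. term_sum ts (matrix_unit (r, c) (k, l)) * X $$ (k, l)) = term_sum ts X"
    using Cons by auto
  ultimately show ?case
    by (simp add: t distrib_right sum.distrib)
qed

text \<open>Locates the support of a tensor row for the weight count. Terms at equal positions may
  cancel, so the listed positions contain the support but can exceed it.\<close>

lemma term_sum_matrix_unit_nonzero:
  assumes "term_sum ts (matrix_unit (r, c) kl) \<noteq> 0"
    and "\<And>s k l. (s, k, l) \<in> set ts \<Longrightarrow> k < r \<and> l < c"
  shows "kl \<in> snd ` set ts"
  using assms
proof (induction ts)
  case (Cons t ts)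
  obtain s a b where t: "t = (s, a, b)" by (cases t)
  show ?case
  proof (cases "kl = (a, b)")
    case True
    then show ?thesis by (simp add: t)
  next
    case False
    have "a < r \<and> b < c" using Cons.prems(2)[of s a b] by (simp add: t)
    with False have "matrix_unit (r, c) kl $$ (a, b) = 0" by (auto simp: matrix_unit_def)
    with Cons.prems(1) have "term_sum ts (matrix_unit (r, c) kl) \<noteq> 0" by (simp add: t)
    then have "kl \<in> snd ` set ts"
      by (rule Cons.IH) (meson Cons.prems(2) list.set_intros(2))
    then show ?thesis by simp
  qed
qed simp

text \<open>The table \<open>L\<close> replaces an abstract linearity proof: once the entries of
  \<open>f\<close> are given by formulas, both the realization and a weight bound of its one-layer
  network follow.\<close>

locale terms_map =
  fixes r c r' c' :: nat and f :: "real mat \<Rightarrow> real mat"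
    and L :: "nat \<Rightarrow> nat \<Rightarrow> (real \<times> nat \<times> nat) list"
  assumes carrier: "X \<in> carrier_mat r c \<Longrightarrow> f X \<in> carrier_mat r' c'"
    and entry: "\<lbrakk>X \<in> carrier_mat r c; i < r'; j < c'\<rbrakk> \<Longrightarrow> f X $$ (i, j) = term_sum (L i j) X"
    and range: "\<lbrakk>i < r'; j < c'; (s, k, l) \<in> set (L i j)\<rbrakk> \<Longrightarrow> k < r \<and> l < c"
begin

lemma matrix_unit_entry:
  assumes "i < r'" "j < c'"
  shows "f (matrix_unit (r, c) kl) $$ (i, j) = term_sum (L i j) (matrix_unit (r, c) kl)"
  using assms by (intro entry) (auto simp: matrix_unit_def)

lemma realization_linear_mnn:
  assumes X: "X \<in> carrier_mat r c"
  shows "realization (linear_mnn (r, c) (r', c') f) X = f X"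
proof (rule eq_matI)
  fix i j
  assume "i < dim_row (f X)" "j < dim_col (f X)"
  then have ij: "i < r'" "j < c'" using carrier[OF X] by auto
  have "realization (linear_mnn (r, c) (r', c') f) X $$ (i, j)
      = (\<Sum>k<r. \<Sum>l<c. term_sum (L i j) (matrix_unit (r, c) (k, l)) * X $$ (k, l))"
    using ij X by (simp add: linear_mnn_def activate_def tensor_apply_def matrix_unit_entry)
  also have "\<dots> = f X $$ (i, j)"
    using sum_term_sum_matrix_unit[OF X range[OF ij]] entry[OF X ij] by simp
  finally show "realization (linear_mnn (r, c) (r', c') f) X $$ (i, j) = f X $$ (i, j)" .
qed (use carrier[OF X] in \<open>auto simp: linear_mnn_def activate_def\<close>)

lemma num_weights_linear_mnn:
  "num_weights (linear_mnn (r, c) (r', c') f) \<le> (\<Sum>i<r'. \<Sum>j<c'. length (L i j))"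
proof -
  let ?T = "mat r' c' (\<lambda>ij. mat r c (\<lambda>kl. f (matrix_unit (r, c) kl) $$ ij))"
  let ?U = "Sigma {..<r'} (\<lambda>i. Sigma {..<c'} (\<lambda>j. snd ` set (L i j)))"
  have "nW_tensor ?T \<le> card ?U"
    unfolding nW_tensor_def
  proof (rule card_mono)
    show "{(i, j, k, l). i < dim_row ?T \<and> j < dim_col ?T \<and> k < dim_row (?T $$ (i, j)) \<and>
      l < dim_col (?T $$ (i, j)) \<and> ?T $$ (i, j) $$ (k, l) \<noteq> 0} \<subseteq> ?U"
    proof clarsimp
      fix i j k l
      assume "i < r'" "j < c'" "f (matrix_unit (r, c) (k, l)) $$ (i, j) \<noteq> 0"
      then show "(k, l) \<in> snd ` set (L i j)"
        using term_sum_matrix_unit_nonzero[OF _ range] by (simp add: matrix_unit_entry)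
    qed
  qed auto
  also have "\<dots> = (\<Sum>i<r'. \<Sum>j<c'. card (snd ` set (L i j)))"
    by simp
  also have "\<dots> \<le> (\<Sum>i<r'. \<Sum>j<c'. length (L i j))"
    by (intro sum_mono) (metis card_image_le card_length finite_set order_trans)
  finally show ?thesis
    by (simp add: num_weights_def linear_mnn_def nW_mat_zero)
qed

end

lemma is_mnn_linear_mnn:
  assumes "0 < r" "0 < c" "0 < r'" "0 < c'"
  shows "is_mnn \<rho> (r, c) (r', c') (linear_mnn (r, c) (r', c') f)"
  unfolding is_mnn_def
  by (intro conjI exI[of _ "\<lambda>s. if s = 0 then (r, c) else (r', c')"])
    (use assms in \<open>auto simp: linear_mnn_def tensor_carrier_def elements_mat_def\<close>)

section \<open>Layers that act on square blocks\<close>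

lemma block_index:
  fixes i h r :: nat
  assumes "i < r * h"
  shows "i div h < r" "i mod h < h" "i div h * h + i mod h = i"
  using assms by (auto simp: less_mult_imp_div_less intro!: mod_less_divisor Nat.gr0I)

lemma block_index_less:
  fixes i h r p :: nat
  assumes "i < h" "p < r"
  shows "p * h + i < r * h"
proof -
  have "p * h + i < Suc p * h" using assms by simp
  also have "\<dots> \<le> r * h" using assms by (intro mult_le_mono1) simp
  finally show ?thesis .
qed

text \<open>Split and mix send blocks of size h to signed sums of blocks of size h, so an entry
  involves only entries at the same offset within their blocks. One small table \<open>t\<close> of
  block positions therefore describes such a layer for every h.\<close>

definition block_terms ::
  "nat \<Rightarrow> (nat \<Rightarrow> nat \<Rightarrow> (real \<times> nat \<times> nat) list) \<Rightarrow> nat \<Rightarrow> nat \<Rightarrow> (real \<times> nat \<times> nat) list" where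
  "block_terms h t i j =
     map (\<lambda>(s, a, b). (s, a * h + i mod h, b * h + j mod h)) (t (i div h) (j div h))"

text \<open>Moves all \<open>div\<close> and \<open>mod\<close> into one place: concrete maps are
  afterwards checked only at indices of the form block number times h plus offset.\<close>

lemma terms_map_blockI:
  fixes f :: "real mat \<Rightarrow> real mat"
  assumes "\<And>X. X \<in> carrier_mat (r * h) (c * h) \<Longrightarrow> f X \<in> carrier_mat (r' * h) (c' * h)"
    and "\<And>X p q i j. \<lbrakk>X \<in> carrier_mat (r * h) (c * h); p < r'; q < c'; i < h; j < h\<rbrakk> \<Longrightarrow>
      f X $$ (p * h + i, q * h + j)
        = term_sum (map (\<lambda>(s, a, b). (s, a * h + i, b * h + j)) (t p q)) X"
    and "\<And>p q s a b. \<lbrakk>p < r'; q < c'; (s, a, b) \<in> set (t p q)\<rbrakk> \<Longrightarrow> a < r \<and> b < c"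
  shows "terms_map (r * h) (c * h) (r' * h) (c' * h) f (block_terms h t)"
proof
  fix X :: "real mat" and i j
  assume "X \<in> carrier_mat (r * h) (c * h)" "i < r' * h" "j < c' * h"
  then show "f X $$ (i, j) = term_sum (block_terms h t i j) X"
    using assms(2)[of X "i div h" "j div h" "i mod h" "j mod h"]
      block_index[of i r' h] block_index[of j c' h]
    by (simp add: block_terms_def)
next
  fix i j s k l
  assume "i < r' * h" "j < c' * h" "(s, k, l) \<in> set (block_terms h t i j)"
  then show "k < r * h \<and> l < c * h"
    using assms(3)[of "i div h" "j div h"] block_index[of i r' h] block_index[of j c' h]
    by (auto simp: block_terms_def intro!: block_index_less)
qed (use assms(1) in auto)

text \<open>Each term of the table is used once for each of the h * h offsets.\<close>

lemma sum_length_block_terms: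
  "(\<Sum>i<r * h. \<Sum>j<c * h. length (block_terms h t i j)) = h * h * (\<Sum>p<r. \<Sum>q<c. length (t p q))"
proof -
  have group: "(\<Sum>i<m * h. g (i div h)) = h * (\<Sum>p<m. g p)" for g :: "nat \<Rightarrow> nat" and m
  proof -
    have "(\<Sum>i<m * h. g (i div h)) = (\<Sum>p<m. \<Sum>i = p * h..<p * h + h. g (i div h))"
      by (rule sum.nat_group[symmetric])
    also have "\<dots> = (\<Sum>p<m. \<Sum>i = p * h..<p * h + h. g p)"
    proof (intro sum.cong refl)
      fix p i
      assume "i \<in> {p * h..<p * h + h}"
      then have "i div h = p"
        by (intro div_nat_eqI) (auto simp: mult.commute)
      then show "g (i div h) = g p" by simp
    qed
    finally show ?thesis by (simp add: sum_distrib_left)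
  qed
  have "(\<Sum>i<r * h. \<Sum>j<c * h. length (block_terms h t i j))
      = (\<Sum>i<r * h. h * (\<Sum>q<c. length (t (i div h) q)))"
    unfolding block_terms_def length_map by (subst group) (rule refl)
  also have "\<dots> = h * h * (\<Sum>p<r. \<Sum>q<c. length (t p q))"
    using group[where g = "\<lambda>p. \<Sum>q<c. length (t p q)" and m = r]
    by (simp flip: sum_distrib_left add: mult.assoc)
  finally show ?thesis .
qed

section \<open>Concatenation and parallelization\<close>

lemma realization_append: "realization (\<Phi> @ \<Psi>) X = realization \<Psi> (realization \<Phi> X)"
  by (induction \<Phi> X rule: realization.induct) auto

lemma num_weights_append: "num_weights (\<Phi> @ \<Psi>) = num_weights \<Phi> + num_weights \<Psi>"
  by (simp add: num_weights_def)

text \<open>The admissible activations form a parameter because they depend on whether the layer is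
  the last one; with \<open>UNIV\<close> only the shapes remain.\<close>

definition layer_ok :: "nat \<times> nat \<Rightarrow> nat \<times> nat \<Rightarrow> (real \<Rightarrow> real) set \<Rightarrow> layer \<Rightarrow> bool" where
  "layer_ok d e F = (\<lambda>(T, C, \<alpha>). T \<in> tensor_carrier e d \<and> C \<in> carrier_mat (fst e) (snd e) \<and>
     \<alpha> \<in> carrier_mat (fst e) (snd e) \<and> elements_mat \<alpha> \<subseteq> F)"

lemma is_mnn_alt:
  "is_mnn \<rho> d d' \<Phi> \<longleftrightarrow> \<Phi> \<noteq> [] \<and> (\<exists>N. N 0 = d \<and> N (length \<Phi>) = d' \<and>
     (\<forall>s\<le>length \<Phi>. 0 < fst (N s) \<and> 0 < snd (N s)) \<and>
     (\<forall>s<length \<Phi>. layer_ok (N s) (N (Suc s)) (if Suc s < length \<Phi> then {id, \<rho>} else {id}) (\<Phi> ! s)))"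
  unfolding is_mnn_def layer_ok_def ..

text \<open>The last layer of the first network becomes a hidden layer. This is legitimate since its
  activations are all \<open>id\<close>, which hidden layers may use as well.\<close>

lemma is_mnn_append:
  assumes "is_mnn \<rho> d e \<Phi>" "is_mnn \<rho> e d' \<Psi>"
  shows "is_mnn \<rho> d d' (\<Phi> @ \<Psi>)"
proof -
  obtain N where N: "N 0 = d" "N (length \<Phi>) = e"
    "\<And>s. s \<le> length \<Phi> \<Longrightarrow> 0 < fst (N s) \<and> 0 < snd (N s)"
    "\<And>s. s < length \<Phi> \<Longrightarrow>
      layer_ok (N s) (N (Suc s)) (if Suc s < length \<Phi> then {id, \<rho>} else {id}) (\<Phi> ! s)"
    and "\<Phi> \<noteq> []"
    using assms(1) unfolding is_mnn_alt by blast
  obtain M where M: "M 0 = e" "M (length \<Psi>) = d'"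
    "\<And>s. s \<le> length \<Psi> \<Longrightarrow> 0 < fst (M s) \<and> 0 < snd (M s)"
    "\<And>s. s < length \<Psi> \<Longrightarrow>
      layer_ok (M s) (M (Suc s)) (if Suc s < length \<Psi> then {id, \<rho>} else {id}) (\<Psi> ! s)"
    and "\<Psi> \<noteq> []"
    using assms(2) unfolding is_mnn_alt by blast
  define P where "P s = (if s \<le> length \<Phi> then N s else M (s - length \<Phi>))" for s
  have P_ge: "P s = M (s - length \<Phi>)" if "length \<Phi> \<le> s" for s
    using that N(2) M(1) by (cases "s = length \<Phi>") (auto simp: P_def)
  show ?thesis
    unfolding is_mnn_alt
  proof (intro conjI exI[of _ P] allI impI)
    fix s
    assume s: "s < length (\<Phi> @ \<Psi>)"
    show "layer_ok (P s) (P (Suc s)) (if Suc s < length (\<Phi> @ \<Psi>) then {id, \<rho>} else {id})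
        ((\<Phi> @ \<Psi>) ! s)"
    proof (cases "s < length \<Phi>")
      case True
      with N(4)[OF True] \<open>\<Psi> \<noteq> []\<close> show ?thesis
        by (auto simp: P_def nth_append layer_ok_def split: if_splits)
    next
      case False
      with s M(4)[of "s - length \<Phi>"] have
        "layer_ok (P s) (P (Suc s)) (if Suc s - length \<Phi> < length \<Psi> then {id, \<rho>} else {id})
          (\<Psi> ! (s - length \<Phi>))"
        using P_ge by (simp add: Suc_diff_le)
      moreover have "Suc s - length \<Phi> < length \<Psi> \<longleftrightarrow> Suc s < length (\<Phi> @ \<Psi>)"
        using False by auto
      ultimately show ?thesis using False by (simp add: nth_append)
    qed
  next
    fix s
    assume "s \<le> length (\<Phi> @ \<Psi>)"
    then have "0 < fst (P s) \<and> 0 < snd (P s)"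
      using N(3)[of s] M(3)[of "s - length \<Phi>"] by (auto simp: P_def)
    then show "0 < fst (P s)" "0 < snd (P s)" by auto
  qed (use \<open>\<Phi> \<noteq> []\<close> N(1) M(2) P_ge[of "length (\<Phi> @ \<Psi>)"] in \<open>auto simp: P_def\<close>)
qed

text \<open>Shape checking by recursion on the list. It admits the empty list and does not single
  out the last layer, so it passes to tails and supports induction over layers, which
  \<open>is_mnn\<close> does not.\<close>

fun layers_ok :: "nat \<times> nat \<Rightarrow> nat \<times> nat \<Rightarrow> mnn \<Rightarrow> bool" where
  "layers_ok d d' [] \<longleftrightarrow> d = d'"
| "layers_ok d d' (x # \<Phi>) \<longleftrightarrow> (\<exists>e. layer_ok d e UNIV x \<and> layers_ok e d' \<Phi>)"

lemma is_mnn_layers_ok: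
  assumes "is_mnn \<rho> d d' \<Phi>"
  shows "layers_ok d d' \<Phi>"
proof -
  have *: "layers_ok (N 0) (N (length \<Phi>)) \<Phi>"
    if "\<And>s. s < length \<Phi> \<Longrightarrow> layer_ok (N s) (N (Suc s)) UNIV (\<Phi> ! s)" for N \<Phi>
    using that
  proof (induction \<Phi> arbitrary: N)
    case (Cons x \<Phi>)
    have "layer_ok (N 0) (N 1) UNIV x"
      using Cons.prems[of 0] by simp
    moreover have "layers_ok (N 1) (N (length (x # \<Phi>))) \<Phi>"
      using Cons.IH[of "\<lambda>s. N (Suc s)"] Cons.prems[of "Suc _"] by simp
    ultimately show ?case unfolding layers_ok.simps by blast
  qed simp
  have mono: "layer_ok d e F x \<Longrightarrow> layer_ok d e UNIV x" for d e F x
    by (auto simp: layer_ok_def)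
  from assms obtain N where N: "N 0 = d" "N (length \<Phi>) = d'"
    "\<And>s. s < length \<Phi> \<Longrightarrow>
      layer_ok (N s) (N (Suc s)) (if Suc s < length \<Phi> then {id, \<rho>} else {id}) (\<Phi> ! s)"
    unfolding is_mnn_alt by blast
  from *[of \<Phi> N, OF mono[OF N(3)]] N(1,2) show ?thesis by simp
qed

text \<open>Holds for \<open>X\<close> of any shape, because a matrix sum takes its shape from the
  second summand, here the bias.\<close>

lemma apply_layer_carrier:
  assumes "layer_ok d (r, c) F (T, C, \<alpha>)"
  shows "activate \<alpha> (tensor_apply T X + C) \<in> carrier_mat r c"
  using assms by (auto simp: layer_ok_def activate_def)

lemma realization_carrier:
  assumes "layers_ok d d' \<Phi>" "X \<in> carrier_mat (fst d) (snd d)"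
  shows "realization \<Phi> X \<in> carrier_mat (fst d') (snd d')"
  using assms
proof (induction \<Phi> arbitrary: d X)
  case (Cons x \<Phi>)
  obtain T C \<alpha> where x: "x = (T, C, \<alpha>)" by (cases x)
  obtain e where e: "layer_ok d e UNIV x" "layers_ok e d' \<Phi>"
    using Cons.prems by auto
  show ?case
    using Cons.IH[OF e(2) apply_layer_carrier] e(1) by (simp add: x)
qed auto

section \<open>Shape and realization of a parallelization\<close>

definition row_block :: "nat \<Rightarrow> nat \<Rightarrow> real mat \<Rightarrow> real mat" where
  "row_block h p X = mat h (dim_col X) (\<lambda>(i, j). X $$ (p * h + i, j))"

definition parallel_layer :: "nat \<Rightarrow> layer \<Rightarrow> layer" where
  "parallel_layer m = (\<lambda>(T, C, \<alpha>). (parallel_tensor m T, stack_copies m C, stack_copies m \<alpha>))"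

lemma parallel_simps [simp]:
  "parallel m [] = []"
  "parallel m (x # \<Phi>) = parallel_layer m x # parallel m \<Phi>"
  by (simp_all add: parallel_def parallel_layer_def)

lemma elements_stack_copies: "elements_mat (stack_copies m C) \<subseteq> elements_mat C"
proof
  fix x
  assume "x \<in> elements_mat (stack_copies m C)"
  then obtain i j where "i < m * dim_row C" "j < dim_col C" "x = C $$ (i mod dim_row C, j)"
    by (auto simp: stack_copies_def elements_mat_def)
  then show "x \<in> elements_mat C"
    using block_index(2)[of i m "dim_row C"]
    by (intro elements_matI[of C "dim_row C" "dim_col C" "i mod dim_row C" j]) auto
qed

lemma layer_ok_parallel:
  assumes "layer_ok (a, b) (r, c) F x"
  shows "layer_ok (m * a, b) (m * r, c) F (parallel_layer m x)"
proof -
  obtain T C \<alpha> where x: "x = (T, C, \<alpha>)" by (cases x)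
  have T: "T \<in> carrier_mat r c" "\<And>i j. i < r \<Longrightarrow> j < c \<Longrightarrow> T $$ (i, j) \<in> carrier_mat a b"
    and C: "C \<in> carrier_mat r c" and \<alpha>: "\<alpha> \<in> carrier_mat r c" "elements_mat \<alpha> \<subseteq> F"
    using assms by (auto simp: x layer_ok_def tensor_carrier_def)
  have "dim_row (T $$ (i mod r, j)) = a" "dim_col (T $$ (i mod r, j)) = b" if "i < m * r" "j < c" for i j
    using T(2)[OF block_index(2)[OF that(1)] that(2)] by auto
  then have "parallel_tensor m T \<in> tensor_carrier (m * r, c) (m * a, b)"
    using T(1) by (simp add: tensor_carrier_def parallel_tensor_def Let_def)
  moreover have "elements_mat (stack_copies m \<alpha>) \<subseteq> F"
    using elements_stack_copies \<alpha>(2) by (rule order_trans)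
  ultimately show ?thesis
    using C \<alpha>(1) by (simp add: x layer_ok_def parallel_layer_def stack_copies_def)
qed

lemma is_mnn_parallel:
  assumes "is_mnn \<rho> (a, b) (r, c) \<Phi>" "0 < m"
  shows "is_mnn \<rho> (m * a, b) (m * r, c) (parallel m \<Phi>)"
proof -
  obtain N where N: "N 0 = (a, b)" "N (length \<Phi>) = (r, c)"
    "\<And>s. s \<le> length \<Phi> \<Longrightarrow> 0 < fst (N s) \<and> 0 < snd (N s)"
    "\<And>s. s < length \<Phi> \<Longrightarrow>
      layer_ok (N s) (N (Suc s)) (if Suc s < length \<Phi> then {id, \<rho>} else {id}) (\<Phi> ! s)"
    and ne: "\<Phi> \<noteq> []"
    using assms(1) unfolding is_mnn_alt by blast
  have len: "length (parallel m \<Phi>) = length \<Phi>"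
    by (simp add: parallel_def)
  have nth: "parallel m \<Phi> ! s = parallel_layer m (\<Phi> ! s)" if "s < length \<Phi>" for s
    using that by (simp add: parallel_def parallel_layer_def)
  show ?thesis
    unfolding is_mnn_alt len
  proof (intro conjI exI[of _ "\<lambda>s. (m * fst (N s), snd (N s))"] allI impI)
    fix s
    assume "s < length \<Phi>"
    then show "layer_ok (m * fst (N s), snd (N s)) (m * fst (N (Suc s)), snd (N (Suc s)))
      (if Suc s < length \<Phi> then {id, \<rho>} else {id}) (parallel m \<Phi> ! s)"
      using N(4) nth layer_ok_parallel by simp
  next
    show "parallel m \<Phi> \<noteq> []" using ne by (simp add: parallel_def)
  qed (use N assms(2) in auto)
qed

text \<open>Collapses a sum against a block diagonal tensor to its single nonzero block.\<close>

lemma sum_block_only: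
  fixes g :: "nat \<Rightarrow> real"
  assumes "p < m"
  shows "(\<Sum>k<m * a. if k div a = p then g k else 0) = (\<Sum>i<a. g (p * a + i))"
proof -
  have "(\<Sum>k<m * a. if k div a = p then g k else 0)
      = (\<Sum>q<m. \<Sum>k = q * a..<q * a + a. if k div a = p then g k else 0)"
    by (rule sum.nat_group[symmetric])
  also have "\<dots> = (\<Sum>q<m. if q = p then \<Sum>k = q * a..<q * a + a. g k else 0)"
  proof (intro sum.cong refl)
    fix q
    have "k div a = q" if "k \<in> {q * a..<q * a + a}" for k
      using that by (intro div_nat_eqI) (auto simp: mult.commute)
    then show "(\<Sum>k = q * a..<q * a + a. if k div a = p then g k else 0)
        = (if q = p then \<Sum>k = q * a..<q * a + a. g k else 0)"
      by (auto intro!: sum.neutral)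
  qed
  also have "\<dots> = (\<Sum>k = p * a..<p * a + a. g k)"
    using assms by simp
  also have "\<dots> = (\<Sum>i<a. g (p * a + i))"
    using sum.shift_bounds_nat_ivl[of g 0 "p * a" a] by (simp add: add.commute lessThan_atLeast0)
  finally show ?thesis .
qed

text \<open>Block diagonality makes row block p of the output depend on row block p of the input
  alone; this is the one-layer step for \<open>row_block_realization_parallel\<close>.\<close>

lemma row_block_parallel_layer:
  assumes ok: "layer_ok (a, b) (r, c) F (T, C, \<alpha>)" and X: "X \<in> carrier_mat (m * a) b" and p: "p < m"
  shows "row_block r p (activate (stack_copies m \<alpha>) (tensor_apply (parallel_tensor m T) X + stack_copies m C))
    = activate \<alpha> (tensor_apply T (row_block a p X) + C)" (is "?l = ?r")
proof (rule eq_matI)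
  have T: "T \<in> carrier_mat r c" "\<And>i j. i < r \<Longrightarrow> j < c \<Longrightarrow> T $$ (i, j) \<in> carrier_mat a b"
    and C: "C \<in> carrier_mat r c" and \<alpha>: "\<alpha> \<in> carrier_mat r c"
    using ok by (auto simp: layer_ok_def tensor_carrier_def)
  have dims: "dim_row ?r = r" "dim_col ?r = c" "dim_row ?l = r" "dim_col ?l = c"
    using T(1) C by (auto simp: row_block_def activate_def stack_copies_def)
  show "dim_row ?l = dim_row ?r" "dim_col ?l = dim_col ?r" using dims by auto
  fix i j
  assume "i < dim_row ?r" "j < dim_col ?r"
  then have ij: "i < r" "j < c" using dims by auto
  have pi: "p * r + i < m * r" using ij p by (intro block_index_less)
  have S: "dim_row (T $$ (i, j)) = a" "dim_col (T $$ (i, j)) = b"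
    using T(2)[OF ij] by auto
  have dm: "(p * r + i) div r = p" "(p * r + i) mod r = i"
    using ij by simp_all
  have "tensor_apply (parallel_tensor m T) X $$ (p * r + i, j)
      = (\<Sum>k<m * a. \<Sum>l<b. (if k div a = p then T $$ (i, j) $$ (k mod a, l) else 0) * X $$ (k, l))"
    using T(1) X ij pi
    by (simp add: tensor_apply_def parallel_tensor_def Let_def dm S cong: if_cong)
  also have "\<dots> = (\<Sum>k<m * a. if k div a = p then \<Sum>l<b. T $$ (i, j) $$ (k mod a, l) * X $$ (k, l) else 0)"
    by (intro sum.cong refl) auto
  also have "\<dots> = (\<Sum>k<a. \<Sum>l<b. T $$ (i, j) $$ ((p * a + k) mod a, l) * X $$ (p * a + k, l))"
    by (rule sum_block_only[OF p])
  also have "\<dots> = tensor_apply T (row_block a p X) $$ (i, j)"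
    using T(1) X ij by (simp add: tensor_apply_def row_block_def)
  finally have "tensor_apply (parallel_tensor m T) X $$ (p * r + i, j)
    = tensor_apply T (row_block a p X) $$ (i, j)" .
  then show "?l $$ (i, j) = ?r $$ (i, j)"
    using T(1) C \<alpha> ij pi by (simp add: row_block_def activate_def stack_copies_def)
qed

lemma row_block_realization_parallel:
  assumes "layers_ok d d' \<Phi>" "X \<in> carrier_mat (m * fst d) (snd d)" "p < m"
  shows "row_block (fst d') p (realization (parallel m \<Phi>) X) = realization \<Phi> (row_block (fst d) p X)"
  using assms
proof (induction \<Phi> arbitrary: d X)
  case (Cons x \<Phi>)
  obtain T C \<alpha> where x: "x = (T, C, \<alpha>)" by (cases x)
  obtain e where e: "layer_ok d e UNIV x" "layers_ok e d' \<Phi>"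
    using Cons.prems by auto
  let ?Y = "activate (stack_copies m \<alpha>) (tensor_apply (parallel_tensor m T) X + stack_copies m C)"
  have "layer_ok (m * fst d, snd d) (m * fst e, snd e) UNIV (parallel_layer m x)"
    using e(1) by (intro layer_ok_parallel) simp
  then have "?Y \<in> carrier_mat (m * fst e) (snd e)"
    by (intro apply_layer_carrier) (simp add: x parallel_layer_def)
  then have "row_block (fst d') p (realization (parallel m \<Phi>) ?Y) = realization \<Phi> (row_block (fst e) p ?Y)"
    using Cons.IH[OF e(2)] Cons.prems(3) by simp
  also have "row_block (fst e) p ?Y = activate \<alpha> (tensor_apply T (row_block (fst d) p X) + C)"
    using e(1) Cons.prems
    by (intro row_block_parallel_layer[where b = "snd d" and c = "snd e" and F = UNIV]) (simp_all add: x)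
  finally show ?case by (simp add: x parallel_layer_def)
qed simp

section \<open>Weights of a parallelization\<close>

lemma nW_mat_stack_copies: "nW_mat (stack_copies m C) \<le> m * nW_mat C"
proof -
  let ?A = "{(i, j). i < dim_row (stack_copies m C) \<and> j < dim_col (stack_copies m C) \<and>
     stack_copies m C $$ (i, j) \<noteq> 0}"
  let ?B = "{(i, j). i < dim_row C \<and> j < dim_col C \<and> C $$ (i, j) \<noteq> 0}"
  \<comment> \<open>A position in the stack is determined by the number of the copy and the position
    inside it.\<close>
  let ?g = "\<lambda>(i, j). (i div dim_row C, i mod dim_row C, j)"
  have fin: "finite ?B"
    by (rule finite_subset[of _ "{..<dim_row C} \<times> {..<dim_col C}"]) auto
  have "card ?A \<le> card ({..<m} \<times> ?B)"
  proof (rule card_inj_on_le)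
    show "inj_on ?g ?A"
      by (auto simp: inj_on_def) (metis div_mult_mod_eq)
    show "?g ` ?A \<subseteq> {..<m} \<times> ?B"
      by (auto simp: stack_copies_def dest: block_index)
  qed (use fin in auto)
  then show ?thesis by (simp add: nW_mat_def card_cartesian_product)
qed

lemma nW_tensor_parallel:
  assumes "T \<in> tensor_carrier (r, c) (a, b)"
  shows "nW_tensor (parallel_tensor m T) \<le> m * nW_tensor T"
proof -
  let ?P = "parallel_tensor m T"
  let ?A = "{(i, j, k, l). i < dim_row ?P \<and> j < dim_col ?P \<and> k < dim_row (?P $$ (i, j)) \<and>
      l < dim_col (?P $$ (i, j)) \<and> ?P $$ (i, j) $$ (k, l) \<noteq> 0}"
  let ?B = "{(i, j, k, l). i < dim_row T \<and> j < dim_col T \<and> k < dim_row (T $$ (i, j)) \<and>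
      l < dim_col (T $$ (i, j)) \<and> T $$ (i, j) $$ (k, l) \<noteq> 0}"
  \<comment> \<open>The copy number is recorded for the row i only. At a nonzero entry block
    diagonality forces \<open>k div a\<close> to be the same number, which is why the map is
    injective there.\<close>
  let ?g = "\<lambda>(i, j, k, l). (i div r, i mod r, j, k mod a, l)"
  have T: "dim_row T = r" "dim_col T = c"
    "\<And>i j. i < r \<Longrightarrow> j < c \<Longrightarrow> dim_row (T $$ (i, j)) = a \<and> dim_col (T $$ (i, j)) = b"
    using assms by (auto simp: tensor_carrier_def)
  have A: "i < m * r \<and> j < c \<and> k < m * a \<and> l < b \<and> i div r = k div a \<and> T $$ (i mod r, j) $$ (k mod a, l) \<noteq> 0"
    if "(i, j, k, l) \<in> ?A" for i j k l
  proof -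
    from that have ij: "i < m * r" "j < c" by (auto simp: parallel_tensor_def T)
    from T(3)[OF block_index(2)[OF ij(1)] ij(2)] ij that show ?thesis
      by (auto simp: parallel_tensor_def T Let_def split: if_splits)
  qed
  have fin: "finite ?B"
    by (rule finite_subset[of _ "{..<r} \<times> {..<c} \<times> {..<a} \<times> {..<b}"]) (auto simp: T)
  have "card ?A \<le> card ({..<m} \<times> ?B)"
  proof (rule card_inj_on_le)
    show "inj_on ?g ?A"
    proof (rule inj_onI)
      fix x y
      assume "x \<in> ?A" "y \<in> ?A" and g: "?g x = ?g y"
      obtain i j k l where x: "x = (i, j, k, l)" by (cases x)
      obtain i' j' k' l' where y: "y = (i', j', k', l')" by (cases y)
      from A \<open>x \<in> ?A\<close> \<open>y \<in> ?A\<close> have "i div r = k div a" "i' div r = k' div a"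
        unfolding x y by blast+
      with g have "i div r = i' div r" "i mod r = i' mod r" "k div a = k' div a" "k mod a = k' mod a"
        "j = j'" "l = l'"
        by (auto simp: x y)
      then show "x = y" unfolding x y by (metis div_mult_mod_eq)
    qed
    show "?g ` ?A \<subseteq> {..<m} \<times> ?B"
    proof
      fix y
      assume "y \<in> ?g ` ?A"
      then obtain i j k l where *: "(i, j, k, l) \<in> ?A" and y: "y = ?g (i, j, k, l)" by auto
      from A[OF *] show "y \<in> {..<m} \<times> ?B"
        using T(3)[of "i mod r" j] by (auto simp: y T(1,2) dest: block_index)
    qed
  qed (use fin in auto)
  then show ?thesis by (simp add: nW_tensor_def card_cartesian_product)
qed

lemma num_weights_parallel:
  assumes "layers_ok d d' \<Phi>"
  shows "num_weights (parallel m \<Phi>) \<le> m * num_weights \<Phi>"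
  using assms
proof (induction \<Phi> arbitrary: d)
  case (Cons x \<Phi>)
  obtain T C \<alpha> where x: "x = (T, C, \<alpha>)" by (cases x)
  obtain e where e: "layer_ok d e UNIV x" "layers_ok e d' \<Phi>"
    using Cons.prems by auto
  have "nW_tensor (parallel_tensor m T) \<le> m * nW_tensor T"
    using e(1) by (intro nW_tensor_parallel[of _ "fst e" "snd e" "fst d" "snd d"]) (simp add: x layer_ok_def)
  with Cons.IH[OF e(2)] nW_mat_stack_copies[of m C] show ?case
    by (simp add: num_weights_def x parallel_layer_def distrib_left)
qed (simp add: num_weights_def)

section \<open>The Strassen networks\<close>

text \<open>
  In the tables, \<open>(s, a, b)\<close> stands for \<open>s\<close> times the block in block row \<open>a\<close> and block column \<open>b\<close>;
  for the split map, the block columns 0, 1 belong to \<open>A\<close> and 2, 3 to \<open>B\<close>.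
\<close>

definition split_tab :: "nat \<Rightarrow> nat \<Rightarrow> (real \<times> nat \<times> nat) list" where
  "split_tab p q =
     [[[(1, 0, 0), (1, 1, 1)], [(1, 0, 2), (1, 1, 3)]],
      [[(1, 1, 0), (1, 1, 1)], [(1, 0, 2)]],
      [[(1, 0, 0)], [(1, 0, 3), (-1, 1, 3)]],
      [[(1, 1, 1)], [(1, 1, 2), (-1, 0, 2)]],
      [[(1, 0, 0), (1, 0, 1)], [(1, 1, 3)]],
      [[(1, 1, 0), (-1, 0, 0)], [(1, 0, 2), (1, 0, 3)]],
      [[(1, 0, 1), (-1, 1, 1)], [(1, 1, 2), (1, 1, 3)]]] ! p ! q"

definition mix_tab :: "nat \<Rightarrow> nat \<Rightarrow> (real \<times> nat \<times> nat) list" where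
  "mix_tab p q =
     [[[(1, 0, 0), (1, 3, 0), (-1, 4, 0), (1, 6, 0)], [(1, 2, 0), (1, 4, 0)]],
      [[(1, 1, 0), (1, 3, 0)], [(1, 0, 0), (-1, 1, 0), (1, 2, 0), (1, 5, 0)]]] ! p ! q"

lemma all_less_2: "(\<forall>p<2::nat. P p) \<longleftrightarrow> P 0 \<and> P 1"
  by (auto simp: less_2_cases_iff)

lemma all_less_7:
  "(\<forall>p<7::nat. P p) \<longleftrightarrow> P 0 \<and> P 1 \<and> P 2 \<and> P 3 \<and> P 4 \<and> P 5 \<and> P 6"
proof -
  have "p < 7 \<longleftrightarrow> p = 0 \<or> p = 1 \<or> p = 2 \<or> p = 3 \<or> p = 4 \<or> p = 5 \<or> p = 6" for p :: nat by linarith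
  then show ?thesis by auto
qed

lemma split_tab_range:
  assumes "p < 7" "q < 2" "(s, a, b) \<in> set (split_tab p q)"
  shows "a < 2 \<and> b < 4"
proof -
  have "\<forall>p<7. \<forall>q<2. \<forall>(s, a, b)\<in>set (split_tab p q). a < 2 \<and> b < 4"
    by (simp add: all_less_7 all_less_2 split_tab_def)
  with assms show ?thesis by blast
qed

lemma mix_tab_range:
  assumes "p < 2" "q < 2" "(s, a, b) \<in> set (mix_tab p q)"
  shows "a < 7 \<and> b < 1"
proof -
  have "\<forall>p<2. \<forall>q<2. \<forall>(s, a, b)\<in>set (mix_tab p q). a < 7 \<and> b < 1"
    by (simp add: all_less_2 mix_tab_def)
  with assms show ?thesis by blast
qed

section \<open>The split and mix maps in terms of blocks\<close>

lemma append_rows_carrier: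
  "U \<in> carrier_mat r w \<Longrightarrow> V \<in> carrier_mat r' w \<Longrightarrow> U @\<^sub>r V \<in> carrier_mat (r + r') w"
  by (auto simp: append_rows_def)

lemma append_rows_entry:
  "\<lbrakk>U \<in> carrier_mat r w; V \<in> carrier_mat r' w; i < r + r'; j < w\<rbrakk> \<Longrightarrow>
    (U @\<^sub>r V) $$ (i, j) = (if i < r then U $$ (i, j) else V $$ (i - r, j))"
  by (auto simp: append_rows_def)

lemma hcat_carrier [simp]:
  "U \<in> carrier_mat r w \<Longrightarrow> V \<in> carrier_mat r w' \<Longrightarrow> hcat U V \<in> carrier_mat r (w + w')"
  by (auto simp: hcat_def)

lemma hcat_entry:
  "\<lbrakk>U \<in> carrier_mat r w; V \<in> carrier_mat r w'; i < r; j < w + w'\<rbrakk> \<Longrightarrow>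
    hcat U V $$ (i, j) = (if j < w then U $$ (i, j) else V $$ (i, j - w))"
  by (auto simp: hcat_def)

lemma append_seven:
  assumes "U0 \<in> carrier_mat h w" "U1 \<in> carrier_mat h w" "U2 \<in> carrier_mat h w"
    "U3 \<in> carrier_mat h w" "U4 \<in> carrier_mat h w" "U5 \<in> carrier_mat h w" "U6 \<in> carrier_mat h w"
  defines "V \<equiv> U0 @\<^sub>r U1 @\<^sub>r U2 @\<^sub>r U3 @\<^sub>r U4 @\<^sub>r U5 @\<^sub>r U6"
  shows "V \<in> carrier_mat (7 * h) w"
    and "\<lbrakk>i < h; j < w\<rbrakk> \<Longrightarrow> \<forall>p<7. V $$ (p * h + i, j) = [U0, U1, U2, U3, U4, U5, U6] ! p $$ (i, j)"
proof -
  \<comment> \<open>The stack associates to the right, so the shapes are collected from the last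
    block upwards.\<close>
  note c5 = append_rows_carrier[OF assms(6,7)]
  note c4 = append_rows_carrier[OF assms(5) c5]
  note c3 = append_rows_carrier[OF assms(4) c4]
  note c2 = append_rows_carrier[OF assms(3) c3]
  note c1 = append_rows_carrier[OF assms(2) c2]
  note c0 = append_rows_carrier[OF assms(1) c1]
  show "V \<in> carrier_mat (7 * h) w" using c0 unfolding V_def by (simp add: numeral_eq_Suc)
  assume "i < h" "j < w"
  then show "\<forall>p<7. V $$ (p * h + i, j) = [U0, U1, U2, U3, U4, U5, U6] ! p $$ (i, j)"
    unfolding V_def all_less_7
    by (simp add: append_rows_entry[OF assms(6,7)] append_rows_entry[OF assms(5) c5]
        append_rows_entry[OF assms(4) c4] append_rows_entry[OF assms(3) c3]
        append_rows_entry[OF assms(2) c2] append_rows_entry[OF assms(1) c1])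
qed

definition block :: "nat \<Rightarrow> real mat \<Rightarrow> nat \<Rightarrow> nat \<Rightarrow> real mat" where
  "block h X a b = mat h h (\<lambda>(i, j). X $$ (a * h + i, b * h + j))"

lemma block_carrier [simp]:
  "block h X a b \<in> carrier_mat h h" "dim_row (block h X a b) = h" "dim_col (block h X a b) = h"
  by (auto simp: block_def)

lemma block_entry [simp]:
  "i < h \<Longrightarrow> j < h \<Longrightarrow> block h X a b $$ (i, j) = X $$ (a * h + i, b * h + j)"
  by (simp add: block_def)

text \<open>Puts the quarters of both factors on one grid of blocks of \<open>X\<close>, the grid to
  which \<open>split_tab\<close> refers.\<close>

lemma split_map_blocks:
  fixes h :: nat and X :: "real mat"
  assumes X: "X \<in> carrier_mat (2 * h) (4 * h)"
  defines "D \<equiv> block h X"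
  shows "split_map X =
    hcat (D 0 0 + D 1 1) (D 0 2 + D 1 3) @\<^sub>r
    hcat (D 1 0 + D 1 1) (D 0 2) @\<^sub>r
    hcat (D 0 0) (D 0 3 - D 1 3) @\<^sub>r
    hcat (D 1 1) (D 1 2 - D 0 2) @\<^sub>r
    hcat (D 0 0 + D 0 1) (D 1 3) @\<^sub>r
    hcat (D 1 0 - D 0 0) (D 0 2 + D 0 3) @\<^sub>r
    hcat (D 0 1 - D 1 1) (D 1 2 + D 1 3)"
proof -
  define A where "A = mat (2 * h) (2 * h) (\<lambda>(i, j). X $$ (i, j))"
  define B where "B = mat (2 * h) (2 * h) (\<lambda>(i, j). X $$ (i, 2 * h + j))"
  have halves: "halves X = (A, B)"
    using X by (auto simp: halves_def split_block_def A_def B_def Let_def add.commute)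
  have "quarters A = (D 0 0, D 0 1, D 1 0, D 1 1)" "quarters B = (D 0 2, D 0 3, D 1 2, D 1 3)"
    by (auto simp: quarters_def split_block_def A_def B_def D_def block_def Let_def add.commute
        add.left_commute intro!: eq_matI)
  with halves show ?thesis by (simp add: split_map_def)
qed

lemma split_map_carrier:
  assumes X: "X \<in> carrier_mat (2 * h) (4 * h)"
  shows "split_map X \<in> carrier_mat (7 * h) (2 * h)"
  unfolding split_map_blocks[OF X]
  by (intro append_seven) (simp_all add: mult_2 minus_carrier_mat)

lemma split_map_entry:
  assumes X: "X \<in> carrier_mat (2 * h) (4 * h)" and pq: "p < 7" "q < 2" and ij: "i < h" "j < h"
  shows "split_map X $$ (p * h + i, q * h + j)
    = term_sum (map (\<lambda>(s, a, b). (s, a * h + i, b * h + j)) (split_tab p q)) X"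
proof -
  let ?D = "block h X"
  have E: "\<forall>p<7. split_map X $$ (p * h + i, j') =
     [hcat (?D 0 0 + ?D 1 1) (?D 0 2 + ?D 1 3), hcat (?D 1 0 + ?D 1 1) (?D 0 2),
      hcat (?D 0 0) (?D 0 3 - ?D 1 3), hcat (?D 1 1) (?D 1 2 - ?D 0 2),
      hcat (?D 0 0 + ?D 0 1) (?D 1 3), hcat (?D 1 0 - ?D 0 0) (?D 0 2 + ?D 0 3),
      hcat (?D 0 1 - ?D 1 1) (?D 1 2 + ?D 1 3)] ! p $$ (i, j')"
    if "j' < h + h" for j'
    unfolding split_map_blocks[OF X]
    by (rule append_seven(2)[OF _ _ _ _ _ _ _ ij(1) that]) (simp_all add: minus_carrier_mat)
  have "\<forall>p<7. \<forall>q<2. split_map X $$ (p * h + i, q * h + j)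
    = term_sum (map (\<lambda>(s, a, b). (s, a * h + i, b * h + j)) (split_tab p q)) X"
    \<comment> \<open>Within a stacked pair, column j falls into the left factor and column h + j
      into the right one.\<close>
    using E[of j] E[of "h + j"] ij unfolding all_less_7 all_less_2
    by (simp add: split_tab_def minus_carrier_mat hcat_entry[where r = h and w = h and w' = h])
  then show ?thesis using pq by blast
qed

lemma terms_map_split:
  "terms_map (2 * h) (4 * h) (7 * h) (2 * h) split_map (block_terms h split_tab)"
  using split_map_carrier split_map_entry split_tab_range by (rule terms_map_blockI)

lemma mix_map_carrier:
  assumes X: "X \<in> carrier_mat (7 * h) (1 * h)"
  shows "mix_map X \<in> carrier_mat (2 * h) (2 * h)"
  using X by (auto simp: mix_map_def Let_def)

lemma mix_map_entry:
  assumes X: "X \<in> carrier_mat (7 * h) (1 * h)" and pq: "p < 2" "q < 2" and ij: "i < h" "j < h"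
  shows "mix_map X $$ (p * h + i, q * h + j)
    = term_sum (map (\<lambda>(s, a, b). (s, a * h + i, b * h + j)) (mix_tab p q)) X"
proof -
  have "\<forall>p<2. \<forall>q<2. mix_map X $$ (p * h + i, q * h + j)
    = term_sum (map (\<lambda>(s, a, b). (s, a * h + i, b * h + j)) (mix_tab p q)) X"
    using X ij unfolding all_less_2 by (simp add: mix_tab_def mix_map_def Let_def)
  then show ?thesis using pq by blast
qed

lemma terms_map_mix:
  "terms_map (7 * h) (1 * h) (2 * h) (2 * h) mix_map (block_terms h mix_tab)"
  using mix_map_carrier mix_map_entry mix_tab_range by (rule terms_map_blockI)

text \<open>Here and in \<open>mix_mnn_Suc\<close> all sizes become multiples of the block size
  \<open>2 ^ k\<close>, as in \<open>terms_map_split\<close> and \<open>terms_map_mix\<close>; this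
  explains the factor 1 in the latter.\<close>

lemma split_mnn_Suc: "split_mnn (Suc k) = linear_mnn (2 * 2 ^ k, 4 * 2 ^ k) (7 * 2 ^ k, 2 * 2 ^ k) split_map"
  by (simp add: split_mnn_def)

lemma mix_mnn_Suc: "mix_mnn (Suc k) = linear_mnn (7 * 2 ^ k, 1 * 2 ^ k) (2 * 2 ^ k, 2 * 2 ^ k) mix_map"
  by (simp add: mix_mnn_def)

section \<open>Shape, weights and layers for powers of two\<close>

lemma is_mnn_strassen_pow2:
  assumes "product_family \<rho> \<Psi>" "0 < \<epsilon>" "0 < K"
  shows "is_mnn \<rho> (2 ^ k, 2 * 2 ^ k) (2 ^ k, 2 ^ k) (strassen_pow2 \<Psi> k \<epsilon> K)"
  using assms(2,3)
proof (induction k arbitrary: \<epsilon> K)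
  case 0
  then show ?case using assms(1) by (simp add: product_family_def product_mnn_def)
next
  case (Suc k)
  let ?h = "2 ^ k :: nat"
  have "is_mnn \<rho> (2 * ?h, 4 * ?h) (7 * ?h, 2 * ?h) (split_mnn (Suc k))"
    unfolding split_mnn_Suc by (intro is_mnn_linear_mnn) auto
  moreover have "is_mnn \<rho> (7 * ?h, 2 * ?h) (7 * ?h, ?h) (parallel 7 (strassen_pow2 \<Psi> k (\<epsilon> / 4) (2 * K)))"
    using Suc by (intro is_mnn_parallel Suc.IH) auto
  moreover have "is_mnn \<rho> (7 * ?h, ?h) (2 * ?h, 2 * ?h) (mix_mnn (Suc k))"
    unfolding mix_mnn_Suc mult_1 by (intro is_mnn_linear_mnn) auto
  ultimately show ?case
    by (auto simp: sparse_concat_def intro: is_mnn_append)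
qed

text \<open>Three of the seven products have two-term sums in both factors and four have one in a
  single factor, which gives 3 * 4 + 4 * 3 = 24 terms for each of the 4 ^ k offsets.\<close>

lemma num_weights_split_mnn: "num_weights (split_mnn (Suc k)) \<le> 24 * 4 ^ k"
proof -
  have "num_weights (split_mnn (Suc k)) \<le> 2 ^ k * 2 ^ k * (\<Sum>p<7. \<Sum>q<2. length (split_tab p q))"
    using terms_map.num_weights_linear_mnn[OF terms_map_split[of "2 ^ k"]]
    unfolding split_mnn_Suc sum_length_block_terms .
  also have "(\<Sum>p<7. \<Sum>q<2. length (split_tab p q)) = 24"
    by (simp add: split_tab_def lessThan_nat_numeral lessThan_Suc)
  finally show ?thesis by (simp flip: power_mult_distrib)
qed

text \<open>The two diagonal blocks combine four products each, the two others two products each: 12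
  terms per offset.\<close>

lemma num_weights_mix_mnn: "num_weights (mix_mnn (Suc k)) \<le> 12 * 4 ^ k"
proof -
  have "num_weights (mix_mnn (Suc k)) \<le> 2 ^ k * 2 ^ k * (\<Sum>p<2. \<Sum>q<2. length (mix_tab p q))"
    using terms_map.num_weights_linear_mnn[OF terms_map_mix[of "2 ^ k"]]
    unfolding mix_mnn_Suc sum_length_block_terms .
  also have "(\<Sum>p<2. \<Sum>q<2. length (mix_tab p q)) = 12"
    by (simp add: mix_tab_def lessThan_nat_numeral lessThan_Suc)
  finally show ?thesis by (simp flip: power_mult_distrib)
qed

text \<open>The 12 is the solution c of 7 * c - 36 = 4 * c: of the 84 * 4 ^ k supplied by seven
  copies of the hypothesis, 36 * 4 ^ k pays for split and mix, and the remaining 48 * 4 ^ k equals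
  12 * 4 ^ Suc k.\<close>

lemma num_weights_strassen_pow2:
  assumes "product_family \<rho> \<Psi>" "0 < \<epsilon>" "0 < K"
  shows "num_weights (strassen_pow2 \<Psi> k \<epsilon> K) + 12 * 4 ^ k
    \<le> 7 ^ k * (num_weights (\<Psi> (\<epsilon> / 4 ^ k) (2 ^ k * K)) + 12)"
  using assms(2,3)
proof (induction k arbitrary: \<epsilon> K)
  case (Suc k)
  let ?\<Phi> = "strassen_pow2 \<Psi> k (\<epsilon> / 4) (2 * K)"
  let ?M = "num_weights (\<Psi> (\<epsilon> / 4 ^ Suc k) (2 ^ Suc k * K)) + 12"
  have ok: "layers_ok (2 ^ k, 2 * 2 ^ k) (2 ^ k, 2 ^ k) ?\<Phi>"
    using Suc.prems by (intro is_mnn_layers_ok[OF is_mnn_strassen_pow2[OF assms(1)]]) auto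
  have "num_weights (strassen_pow2 \<Psi> (Suc k) \<epsilon> K) \<le> 36 * 4 ^ k + 7 * num_weights ?\<Phi>"
    using num_weights_parallel[OF ok, of 7] num_weights_split_mnn[of k] num_weights_mix_mnn[of k]
    by (simp add: sparse_concat_def num_weights_append)
  moreover have "num_weights ?\<Phi> + 12 * 4 ^ k \<le> 7 ^ k * ?M"
    using Suc.IH[of "\<epsilon> / 4" "2 * K"] Suc.prems by (simp add: ac_simps)
  ultimately show ?case by simp
qed simp

lemma num_layers_strassen_pow2:
  "num_layers (strassen_pow2 \<Psi> k \<epsilon> K) = num_layers (\<Psi> (\<epsilon> / 4 ^ k) (2 ^ k * K)) + 2 * k"
proof (induction k arbitrary: \<epsilon> K)
  case (Suc k)
  from Suc[of "\<epsilon> / 4" "2 * K"] show ?case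
    by (simp add: num_layers_def sparse_concat_def parallel_def split_mnn_def mix_mnn_def
        linear_mnn_def ac_simps)
qed simp

section \<open>Accuracy for powers of two\<close>

lemma strassen_identities:
  fixes a11 a12 a21 a22 b11 b12 b21 b22 :: "'i \<Rightarrow> 'a :: comm_ring_1"
    and I :: "'i set"
  defines "P1 \<equiv> \<Sum>l\<in>I. (a11 l + a22 l) * (b11 l + b22 l)"
    and "P2 \<equiv> \<Sum>l\<in>I. (a21 l + a22 l) * b11 l"
    and "P3 \<equiv> \<Sum>l\<in>I. a11 l * (b12 l - b22 l)"
    and "P4 \<equiv> \<Sum>l\<in>I. a22 l * (b21 l - b11 l)"
    and "P5 \<equiv> \<Sum>l\<in>I. (a11 l + a12 l) * b22 l"
    and "P6 \<equiv> \<Sum>l\<in>I. (a21 l - a11 l) * (b11 l + b12 l)"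
    and "P7 \<equiv> \<Sum>l\<in>I. (a12 l - a22 l) * (b21 l + b22 l)"
  shows "P1 + P4 - P5 + P7 = (\<Sum>l\<in>I. a11 l * b11 l) + (\<Sum>l\<in>I. a12 l * b21 l)"
    and "P3 + P5 = (\<Sum>l\<in>I. a11 l * b12 l) + (\<Sum>l\<in>I. a12 l * b22 l)"
    and "P2 + P4 = (\<Sum>l\<in>I. a21 l * b11 l) + (\<Sum>l\<in>I. a22 l * b21 l)"
    and "P1 - P2 + P3 + P6 = (\<Sum>l\<in>I. a21 l * b12 l) + (\<Sum>l\<in>I. a22 l * b22 l)"
  \<comment> \<open>For a fixed row and column the identities already hold for each inner index l
    separately.\<close>
  unfolding assms by (simp_all add: algebra_simps sum.distrib sum_subtractf)

lemma sum_two_blocks: "(\<Sum>l<2 * h. g l) = (\<Sum>l<h. g l) + (\<Sum>l<h. g (h + l))" for g :: "nat \<Rightarrow> real"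
proof -
  have "(\<Sum>l<2 * h. g l) = (\<Sum>q<2. \<Sum>l = q * h..<q * h + h. g l)"
    by (rule sum.nat_group[symmetric])
  also have "\<dots> = (\<Sum>l<h. g l) + (\<Sum>l = h..<h + h. g l)"
    by (simp add: lessThan_nat_numeral lessThan_Suc atLeast0LessThan add.commute)
  also have "(\<Sum>l = h..<h + h. g l) = (\<Sum>l<h. g (h + l))"
    using sum.shift_bounds_nat_ivl[of g 0 h h] by (simp add: add.commute atLeast0LessThan)
  finally show ?thesis .
qed

lemma split_map_bound:
  assumes X: "X \<in> carrier_mat (2 * h) (4 * h)"
    and bound: "\<And>i j. i < 2 * h \<Longrightarrow> j < 4 * h \<Longrightarrow> \<bar>X $$ (i, j)\<bar> \<le> K"
    and ij: "i < 7 * h" "j < 2 * h"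
  shows "\<bar>split_map X $$ (i, j)\<bar> \<le> 2 * K"
proof -
  obtain p q i' j' where pq: "p < 7" "q < 2" and ij': "i' < h" "j' < h" "i = p * h + i'" "j = q * h + j'"
    using block_index[OF ij(1)] block_index[OF ij(2)] by metis
  have X_bound: "\<bar>X $$ (a * h + i', b * h + j')\<bar> \<le> K" if "a < 2" "b < 4" for a b
    using that ij' by (intro bound block_index_less)
  \<comment> \<open>Read off from an actual entry; it is needed to raise the bound for a one-term
    entry from \<open>K\<close> to \<open>2 * K\<close>.\<close>
  have K: "0 \<le> K" using X_bound[of 0 0] by linarith
  have "\<bar>term_sum (map (\<lambda>(s, a, b). (s, a * h + i', b * h + j')) ts) X\<bar> \<le> length ts * K"
    if "\<And>s a b. (s, a, b) \<in> set ts \<Longrightarrow> \<bar>s\<bar> = 1 \<and> a < 2 \<and> b < 4" for ts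
    using that
  proof (induction ts)
    case (Cons t ts)
    obtain s a b where t: "t = (s, a, b)" by (cases t)
    have "\<bar>s\<bar> = 1" "a < 2" "b < 4" using Cons.prems[of s a b] by (auto simp: t)
    then have "\<bar>s * X $$ (a * h + i', b * h + j')\<bar> \<le> K"
      using X_bound by (simp add: abs_mult)
    moreover have "\<bar>term_sum (map (\<lambda>(s, a, b). (s, a * h + i', b * h + j')) ts) X\<bar> \<le> length ts * K"
      by (rule Cons.IH) (meson Cons.prems list.set_intros(2))
    ultimately show ?case by (simp add: t distrib_right)
  qed simp
  moreover have "\<forall>p<7. \<forall>q<2. length (split_tab p q) \<le> 2 \<and> (\<forall>(s, a, b)\<in>set (split_tab p q). \<bar>s\<bar> = 1)"
    by (simp add: all_less_7 all_less_2 split_tab_def)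
  then have len: "length (split_tab p q) \<le> 2" and "\<And>s a b. (s, a, b) \<in> set (split_tab p q) \<Longrightarrow> \<bar>s\<bar> = 1"
    using pq by blast+
  ultimately have "\<bar>split_map X $$ (i, j)\<bar> \<le> length (split_tab p q) * K"
    using split_map_entry[OF X pq ij'(1,2)] split_tab_range[OF pq] ij'(3,4) by metis
  also have "\<dots> \<le> 2 * K"
    using len K by (intro mult_right_mono) auto
  finally show ?thesis .
qed

text \<open>The exact product is expressed through the concatenated input, its second factor
  starting at column \<open>2 ^ k\<close>. In this form the induction hypothesis applies directly to
  the row blocks of the split input.\<close>

lemma strassen_pow2_accuracy:
  assumes "product_family \<rho> \<Psi>" "0 < \<epsilon>" "0 < K" "X \<in> carrier_mat (2 ^ k) (2 * 2 ^ k)"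
    and "\<And>i j. i < 2 ^ k \<Longrightarrow> j < 2 * 2 ^ k \<Longrightarrow> \<bar>X $$ (i, j)\<bar> \<le> K"
    and "i < 2 ^ k" "j < 2 ^ k"
  shows "\<bar>realization (strassen_pow2 \<Psi> k \<epsilon> K) X $$ (i, j)
    - (\<Sum>l<2 ^ k. X $$ (i, l) * X $$ (l, 2 ^ k + j))\<bar> \<le> \<epsilon>"
  using assms(2-)
proof (induction k arbitrary: \<epsilon> K X i j)
  case 0
  have "X = mat_of_rows_list 2 [[X $$ (0, 0), X $$ (0, 1)]]"
    using 0(3) by (intro eq_matI) (auto simp: mat_of_rows_list_def less_2_cases_iff)
  moreover have "product_mnn \<rho> \<epsilon> K (\<Psi> \<epsilon> K)"
    using assms(1) 0 by (simp add: product_family_def)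
  moreover have "\<bar>X $$ (0, 0)\<bar> \<le> K" "\<bar>X $$ (0, 1)\<bar> \<le> K"
    using 0 by simp_all
  ultimately have "\<bar>X $$ (0, 0) * X $$ (0, 1) - realization (\<Psi> \<epsilon> K) X $$ (0, 0)\<bar> \<le> \<epsilon>"
    unfolding product_mnn_def by (metis abs_le_iff atLeastAtMost_iff minus_le_iff)
  with 0 show ?case by (simp add: abs_minus_commute)
next
  case (Suc k)
  define h :: nat where "h = 2 ^ k"
  let ?\<Phi> = "strassen_pow2 \<Psi> k (\<epsilon> / 4) (2 * K)"
  define S where "S = split_map X"
  define Y where "Y = realization (parallel 7 ?\<Phi>) S"
  define Z where "Z p = row_block h p S" for p
  \<comment> \<open>The exact value of the product that \<open>Y\<close> contains approximately.
    Counting starts at 0, so \<open>D p\<close> belongs to Strassen's product number p + 1.\<close>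
  define D where "D p i j = (\<Sum>l<h. Z p $$ (i, l) * Z p $$ (l, h + j))" for p i j
  have X: "X \<in> carrier_mat (2 * h) (4 * h)"
    and X_bound: "\<And>i j. i < 2 * h \<Longrightarrow> j < 4 * h \<Longrightarrow> \<bar>X $$ (i, j)\<bar> \<le> K"
    using Suc.prems(3,4) by (simp_all add: h_def)
  have S: "S \<in> carrier_mat (7 * h) (2 * h)"
    unfolding S_def by (rule split_map_carrier[OF X])
  have ok: "is_mnn \<rho> (h, 2 * h) (h, h) ?\<Phi>"
    unfolding h_def using Suc.prems by (intro is_mnn_strassen_pow2[OF assms(1)]) auto
  have Y: "Y \<in> carrier_mat (7 * h) (1 * h)"
    using realization_carrier[OF is_mnn_layers_ok[OF is_mnn_parallel[OF ok]], of 7 S] S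
    by (simp add: Y_def)
  have Y_block: "row_block h p Y = realization ?\<Phi> (Z p)" if "p < 7" for p
    using row_block_realization_parallel[OF is_mnn_layers_ok[OF ok], of S 7 p] S that
    by (simp add: Y_def Z_def)
  have Z_entry: "Z p $$ (i, q * h + j)
      = term_sum (map (\<lambda>(s, a, b). (s, a * h + i, b * h + j)) (split_tab p q)) X"
    if "p < 7" "q < 2" "i < h" "j < h" for p q i j
    using split_map_entry[OF X that] S block_index_less[OF that(4,2)] that(3)
    by (simp add: Z_def row_block_def S_def)
  have Y_close: "\<bar>Y $$ (p * h + i, j) - D p i j\<bar> \<le> \<epsilon> / 4" if "p < 7" "i < h" "j < h" for p i j
  proof -
    have "Z p \<in> carrier_mat (2 ^ k) (2 * 2 ^ k)"
      using S by (simp add: Z_def row_block_def h_def)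
    moreover have "\<bar>Z p $$ (i, j)\<bar> \<le> 2 * K" if "i < 2 ^ k" "j < 2 * 2 ^ k" for i j
      using split_map_bound[OF X X_bound block_index_less[OF _ \<open>p < 7\<close>]] that S
      by (simp add: Z_def row_block_def S_def h_def)
    ultimately have "\<bar>realization ?\<Phi> (Z p) $$ (i, j) - D p i j\<bar> \<le> \<epsilon> / 4"
      using Suc.prems(1,2) that unfolding D_def h_def by (intro Suc.IH) auto
    moreover have "realization ?\<Phi> (Z p) $$ (i, j) = Y $$ (p * h + i, j)"
      using Y that by (simp add: row_block_def flip: Y_block)
    ultimately show ?thesis by simp
  qed
  have goal: "\<bar>mix_map Y $$ (p * h + i, q * h + j)
      - (\<Sum>l<2 * h. X $$ (p * h + i, l) * X $$ (l, 2 * h + (q * h + j)))\<bar> \<le> \<epsilon>"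
    if "p < 2" "q < 2" and ij: "i < h" "j < h" for p q i j
  proof -
    \<comment> \<open>With i and j fixed, \<open>a r c\<close> is a row of a quarter of the first
      factor and \<open>b r c\<close> a column of a quarter of the second; the shift by 2 skips the
      block columns of the first factor.\<close>
    define a where "a r c l = X $$ (r * h + i, c * h + l)" for r c l
    define b where "b r c l = X $$ (r * h + l, (2 + c) * h + j)" for r c l
    have Z_left: "Z p $$ (i, l) = term_sum (map (\<lambda>(s, a, b). (s, a * h + i, b * h + l)) (split_tab p 0)) X"
      if "p < 7" "l < h" for p l
      using Z_entry[OF that(1) _ ij(1) that(2), of 0] by simp
    have Z_right: "Z p $$ (l, h + j) = term_sum (map (\<lambda>(s, a, b). (s, a * h + l, b * h + j)) (split_tab p 1)) X"
      if "p < 7" "l < h" for p l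
      using Z_entry[OF that(1) _ that(2) ij(2), of 1] by simp
    have D: "D 0 i j = (\<Sum>l<h. (a 0 0 l + a 1 1 l) * (b 0 0 l + b 1 1 l))"
      "D 1 i j = (\<Sum>l<h. (a 1 0 l + a 1 1 l) * b 0 0 l)"
      "D 2 i j = (\<Sum>l<h. a 0 0 l * (b 0 1 l - b 1 1 l))"
      "D 3 i j = (\<Sum>l<h. a 1 1 l * (b 1 0 l - b 0 0 l))"
      "D 4 i j = (\<Sum>l<h. (a 0 0 l + a 0 1 l) * b 1 1 l)"
      "D 5 i j = (\<Sum>l<h. (a 1 0 l - a 0 0 l) * (b 0 0 l + b 0 1 l))"
      "D 6 i j = (\<Sum>l<h. (a 0 1 l - a 1 1 l) * (b 1 0 l + b 1 1 l))"
      by (simp_all add: D_def Z_left Z_right split_tab_def a_def b_def)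
    have prod: "(\<Sum>l<2 * h. X $$ (p * h + i, l) * X $$ (l, 2 * h + (q * h + j)))
        = (\<Sum>l<h. a p 0 l * b 0 q l) + (\<Sum>l<h. a p 1 l * b 1 q l)" for p q
      unfolding sum_two_blocks a_def b_def distrib_right[of 2 q h] add.assoc by simp
    have sums: "D 0 i j + D 3 i j - D 4 i j + D 6 i j = (\<Sum>l<h. a 0 0 l * b 0 0 l) + (\<Sum>l<h. a 0 1 l * b 1 0 l)"
      "D 2 i j + D 4 i j = (\<Sum>l<h. a 0 0 l * b 0 1 l) + (\<Sum>l<h. a 0 1 l * b 1 1 l)"
      "D 1 i j + D 3 i j = (\<Sum>l<h. a 1 0 l * b 0 0 l) + (\<Sum>l<h. a 1 1 l * b 1 0 l)"
      "D 0 i j - D 1 i j + D 2 i j + D 5 i j = (\<Sum>l<h. a 1 0 l * b 0 1 l) + (\<Sum>l<h. a 1 1 l * b 1 1 l)"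
      unfolding D by (rule strassen_identities)+
    define y where "y p = Y $$ (p * h + i, j)" for p
    define d where "d p = D p i j" for p
    have close: "y p - d p \<le> \<epsilon> / 4" "d p - y p \<le> \<epsilon> / 4" if "p < 7" for p
      using Y_close[OF that ij] unfolding y_def d_def by linarith+
    \<comment> \<open>Both diagonal blocks contain exactly one minus sign. Writing the first as
      \<open>y 3 - y 4 + y 0 + y 6\<close> gives it the sign pattern of the other, so one estimate
      with four errors of \<epsilon> / 4 covers both.\<close>
    have perturb4: "\<bar>y p - y q + y r + y s - (d p - d q + d r + d s)\<bar> \<le> \<epsilon>"
      if "p < 7" "q < 7" "r < 7" "s < 7" for p q r s
      using close[OF that(1)] close[OF that(2)] close[OF that(3)] close[OF that(4)]
      by (intro abs_leI) linarith+
    have perturb2: "\<bar>y p + y q - (d p + d q)\<bar> \<le> \<epsilon>" if "p < 7" "q < 7" for p q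
      using close[OF that(1)] close[OF that(2)] \<open>0 < \<epsilon>\<close> by (intro abs_leI) linarith+
    have mix: "mix_map Y $$ (p * h + i, q * h + j)
        = term_sum (map (\<lambda>(s, a, b). (s, a * h + i, b * h + j)) (mix_tab p q)) Y"
      if "p < 2" "q < 2" for p q
      by (rule mix_map_entry[OF Y that ij])
    \<comment> \<open>The indices keep the form \<open>0 * h + i\<close> and
      \<open>1 * h + i\<close> in which \<open>all_less_2\<close> later produces them.\<close>
    have "mix_map Y $$ (0 * h + i, 0 * h + j) = y 3 - y 4 + y 0 + y 6"
      "mix_map Y $$ (0 * h + i, 1 * h + j) = y 2 + y 4"
      "mix_map Y $$ (1 * h + i, 0 * h + j) = y 1 + y 3"
      "mix_map Y $$ (1 * h + i, 1 * h + j) = y 0 - y 1 + y 2 + y 5"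
      by (subst mix; simp add: mix_tab_def y_def)+
    moreover have "d 3 - d 4 + d 0 + d 6 = (\<Sum>l<h. a 0 0 l * b 0 0 l) + (\<Sum>l<h. a 0 1 l * b 1 0 l)"
      "d 2 + d 4 = (\<Sum>l<h. a 0 0 l * b 0 1 l) + (\<Sum>l<h. a 0 1 l * b 1 1 l)"
      "d 1 + d 3 = (\<Sum>l<h. a 1 0 l * b 0 0 l) + (\<Sum>l<h. a 1 1 l * b 1 0 l)"
      "d 0 - d 1 + d 2 + d 5 = (\<Sum>l<h. a 1 0 l * b 0 1 l) + (\<Sum>l<h. a 1 1 l * b 1 1 l)"
      unfolding d_def sums[symmetric] by simp_all
    ultimately have "\<forall>p<2. \<forall>q<2. \<bar>mix_map Y $$ (p * h + i, q * h + j)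
      - (\<Sum>l<2 * h. X $$ (p * h + i, l) * X $$ (l, 2 * h + (q * h + j)))\<bar> \<le> \<epsilon>"
      unfolding prod all_less_2
      using perturb4[of 3 4 0 6] perturb2[of 2 4] perturb2[of 1 3] perturb4[of 0 1 2 5]
      by (simp only:)
    then show ?thesis using that by blast
  qed
  have i: "i < 2 * h" and j: "j < 2 * h"
    using Suc.prems(5,6) by (simp_all add: h_def)
  have "realization (strassen_pow2 \<Psi> (Suc k) \<epsilon> K) X = mix_map Y"
    using terms_map.realization_linear_mnn[OF terms_map_split X]
      terms_map.realization_linear_mnn[OF terms_map_mix Y]
    by (simp add: sparse_concat_def realization_append split_mnn_Suc mix_mnn_Suc Y_def S_def h_def)
  moreover have "\<bar>mix_map Y $$ (i, j) - (\<Sum>l<2 * h. X $$ (i, l) * X $$ (l, 2 * h + j))\<bar> \<le> \<epsilon>"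
    using goal[OF block_index(1)[OF i] block_index(1)[OF j] block_index(2)[OF i] block_index(2)[OF j]]
    unfolding block_index(3)[OF i] block_index(3)[OF j] .
  ultimately show ?case by (simp add: h_def)
qed

lemma max_abs_le_iff:
  assumes "X \<in> carrier_mat r c" "0 < r" "0 < c"
  shows "max_abs X \<le> K \<longleftrightarrow> (\<forall>i<r. \<forall>j<c. \<bar>X $$ (i, j)\<bar> \<le> K)"
proof -
  have "elements_mat X = (\<lambda>(i, j). X $$ (i, j)) ` ({..<r} \<times> {..<c})"
    using assms(1) by (auto simp: elements_mat_def)
  \<comment> \<open>The index set is nonempty; \<open>Max\<close> of the empty set would be
    unspecified.\<close>
  moreover have "(0, 0) \<in> {..<r} \<times> {..<c}" using assms by simp
  ultimately show ?thesis
    by (subst max_abs_def, subst Max_le_iff) auto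
qed

lemma ceil_log2_bounds:
  assumes "1 \<le> n"
  shows "n \<le> 2 ^ ceil_log2 n" "2 ^ ceil_log2 n \<le> 2 * n" "real (ceil_log2 n) \<le> log 2 n + 1"
proof -
  \<comment> \<open>Ensures that \<open>nat\<close> does not truncate the ceiling.\<close>
  have "0 \<le> log 2 (real n)" using assms by simp
  then have k: "real (ceil_log2 n) = of_int \<lceil>log 2 (real n)\<rceil>"
    unfolding ceil_log2_def by (subst of_nat_nat) auto
  then show le: "real (ceil_log2 n) \<le> log 2 n + 1" by linarith
  have pow: "2 powr (log 2 (real n)) = real n" "2 powr (ceil_log2 n) = real (2 ^ ceil_log2 n)"
    using assms by (simp_all add: powr_realpow)
  have "2 powr (log 2 (real n)) \<le> 2 powr (ceil_log2 n)"
    using k by (intro powr_mono) auto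
  then show "n \<le> 2 ^ ceil_log2 n" unfolding pow by linarith
  have "2 powr (ceil_log2 n) \<le> 2 powr (log 2 (real n) + 1)"
    using le by (intro powr_mono) auto
  then have "real (2 ^ ceil_log2 n) \<le> real (2 * n)"
    unfolding powr_add pow by simp
  then show "2 ^ ceil_log2 n \<le> 2 * n"
    by (simp only: of_nat_le_iff)
qed

section \<open>Padding to a power of two\<close>

definition ext_map :: "nat \<Rightarrow> real mat \<Rightarrow> real mat" where
  "ext_map m X = (case halves X of (A, B) \<Rightarrow> hcat (zero_pad m A) (zero_pad m B))"

text \<open>Padded positions get the empty list, so that they contribute neither a value nor a
  weight.\<close>

definition ext_terms :: "nat \<Rightarrow> nat \<Rightarrow> nat \<Rightarrow> nat \<Rightarrow> (real \<times> nat \<times> nat) list" where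
  "ext_terms n m i j =
     (if i < n \<and> j < n then [(1, i, j)]
      else if i < n \<and> m \<le> j \<and> j < m + n then [(1, i, n + (j - m))] else [])"

lemma zero_pad_carrier: "A \<in> carrier_mat n n \<Longrightarrow> n \<le> m \<Longrightarrow> zero_pad m A \<in> carrier_mat m m"
  by (auto simp: zero_pad_def)

lemma zero_pad_entry:
  "\<lbrakk>A \<in> carrier_mat n n; n \<le> m; i < m; j < m\<rbrakk> \<Longrightarrow>
    zero_pad m A $$ (i, j) = (if i < n \<and> j < n then A $$ (i, j) else 0)"
  by (auto simp: zero_pad_def)

lemma terms_map_ext:
  assumes "n \<le> m"
  shows "terms_map n (2 * n) m (2 * m) (ext_map m) (ext_terms n m)"
proof
  fix X :: "real mat"
  assume X: "X \<in> carrier_mat n (2 * n)"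
  define A where "A = mat n n (\<lambda>(i, j). X $$ (i, j))"
  define B where "B = mat n n (\<lambda>(i, j). X $$ (i, n + j))"
  have AB: "A \<in> carrier_mat n n" "B \<in> carrier_mat n n" by (auto simp: A_def B_def)
  have ext: "ext_map m X = hcat (zero_pad m A) (zero_pad m B)"
    using X by (auto simp: ext_map_def halves_def split_block_def A_def B_def Let_def add.commute
        intro!: arg_cong2[where f = hcat] arg_cong[where f = "zero_pad m"])
  note pads = zero_pad_carrier[OF AB(1) assms] zero_pad_carrier[OF AB(2) assms]
  show "ext_map m X \<in> carrier_mat m (2 * m)"
    unfolding ext mult_2 using pads by simp
  fix i j
  assume ij: "i < m" "j < 2 * m"
  then have "ext_map m X $$ (i, j) =
      (if j < m then if i < n \<and> j < n then A $$ (i, j) else 0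
       else if i < n \<and> j - m < n then B $$ (i, j - m) else 0)"
    unfolding ext
    by (auto simp: hcat_entry[OF pads] zero_pad_entry[OF AB(1) assms] zero_pad_entry[OF AB(2) assms])
  also have "\<dots> = term_sum (ext_terms n m i j) X"
    using ij assms by (auto simp: ext_terms_def A_def B_def)
  finally show "ext_map m X $$ (i, j) = term_sum (ext_terms n m i j) X" .
next
  fix i j s k l
  assume "i < m" "j < 2 * m" "(s, k, l) \<in> set (ext_terms n m i j)"
  then show "k < n \<and> l < 2 * n"
    by (auto simp: ext_terms_def split: if_splits)
qed

lemma sum_length_ext_terms:
  assumes "n \<le> m"
  shows "(\<Sum>i<m. \<Sum>j<2 * m. length (ext_terms n m i j)) \<le> 2 * n\<^sup>2"
proof -
  \<comment> \<open>The positions with a term: one n by n square for each factor.\<close>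
  let ?U = "{..<n} \<times> ({..<n} \<union> {m..<m + n})"
  have "(\<Sum>i<m. \<Sum>j<2 * m. length (ext_terms n m i j))
      = (\<Sum>x\<in>{..<m} \<times> {..<2 * m}. if x \<in> ?U then 1 else 0)"
    unfolding sum.cartesian_product by (intro sum.cong refl) (auto simp: ext_terms_def split: if_splits)
  also have "\<dots> = card (({..<m} \<times> {..<2 * m}) \<inter> ?U)"
    by (subst sum.If_cases) (auto simp: Int_def)
  also have "\<dots> \<le> card ?U"
    by (intro card_mono) auto
  also have "\<dots> \<le> n * (n + n)"
    unfolding card_cartesian_product using card_Un_le[of "{..<n}" "{m..<m + n}"] by simp
  finally show ?thesis by (simp add: power2_eq_square distrib_left)
qed

lemma terms_map_shrink:
  assumes "n \<le> m"
  shows "terms_map m m n n (shrink n n) (\<lambda>i j. [(1, i, j)])"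
  by standard (use assms in \<open>auto simp: shrink_def\<close>)

lemma ext_mnn_eq:
  "ext_mnn n = linear_mnn (n, 2 * n) (2 ^ ceil_log2 n, 2 * 2 ^ ceil_log2 n) (ext_map (2 ^ ceil_log2 n))"
  by (simp add: ext_mnn_def ext_map_def[abs_def] Let_def)

lemma shr_mnn_eq:
  "shr_mnn n = linear_mnn (2 ^ ceil_log2 n, 2 ^ ceil_log2 n) (n, n) (shrink n n)"
  by (simp add: shr_mnn_def Let_def)

section \<open>Networks for matrices of any size\<close>

lemma is_mnn_strassen:
  assumes "product_family \<rho> \<Psi>" "1 \<le> n" "0 < \<epsilon>" "0 < K"
  shows "is_mnn \<rho> (n, 2 * n) (n, n) (strassen \<Psi> n \<epsilon> K)"
  unfolding strassen_def sparse_concat_def ext_mnn_eq shr_mnn_eq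
  by (rule is_mnn_append[OF is_mnn_append[OF is_mnn_linear_mnn
          is_mnn_strassen_pow2[OF assms(1,3,4)]] is_mnn_linear_mnn]) (use assms(2) in auto)

text \<open>Zero padding keeps the entries bounded by \<open>K\<close>, so the power-of-two case
  applies, and it leaves the upper left block of the product unchanged.\<close>

lemma strassen_accuracy:
  assumes family: "product_family \<rho> \<Psi>" and n: "1 \<le> n" and pos: "0 < \<epsilon>" "0 < K"
    and A: "A \<in> carrier_mat n n" and B: "B \<in> carrier_mat n n"
    and bound: "max_abs A \<le> K" "max_abs B \<le> K"
  shows "max_abs (realization (strassen \<Psi> n \<epsilon> K) (hcat A B) - A * B) \<le> \<epsilon>"
proof -
  define k where "k = ceil_log2 n"
  define m :: nat where "m = 2 ^ k"
  have nm: "n \<le> m" using ceil_log2_bounds(1)[OF n] by (simp add: m_def k_def)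
  define X where "X = ext_map m (hcat A B)"
  define Y where "Y = realization (strassen_pow2 \<Psi> k \<epsilon> K) X"
  have H: "hcat A B \<in> carrier_mat n (2 * n)"
    using A B by (simp add: mult_2)
  note ext = terms_map_ext[OF nm]
  have X: "X \<in> carrier_mat m (2 * m)"
    unfolding X_def by (rule terms_map.carrier[OF ext H])
  have entry: "X $$ (i, j) = term_sum (ext_terms n m i j) (hcat A B)" if "i < m" "j < 2 * m" for i j
    unfolding X_def by (rule terms_map.entry[OF ext H that])
  have X_left: "X $$ (i, j) = (if i < n \<and> j < n then A $$ (i, j) else 0)"
    if "i < m" "j < m" for i j
    using that A B nm by (auto simp: entry ext_terms_def hcat_entry[OF A B])
  have X_right: "X $$ (i, m + j) = (if i < n \<and> j < n then B $$ (i, j) else 0)"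
    if "i < m" "j < m" for i j
    using that A B nm by (auto simp: entry ext_terms_def hcat_entry[OF A B])
  have AB: "\<bar>A $$ (i, j)\<bar> \<le> K" "\<bar>B $$ (i, j)\<bar> \<le> K" if "i < n" "j < n" for i j
    using bound n that max_abs_le_iff[OF A] max_abs_le_iff[OF B] by auto
  have X_bound: "\<bar>X $$ (i, j)\<bar> \<le> K" if "i < m" "j < 2 * m" for i j
  proof (cases "j < m")
    case True
    then show ?thesis using that AB(1) pos by (auto simp: X_left)
  next
    case False
    then obtain j' where "j = m + j'" by (auto simp: not_less le_iff_add)
    then show ?thesis using that AB(2) pos by (simp add: X_right)
  qed
  have Y: "Y \<in> carrier_mat m m"
    using realization_carrier[OF is_mnn_layers_ok[OF is_mnn_strassen_pow2[OF family pos]]] X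
    by (simp add: Y_def m_def)
  have R: "realization (strassen \<Psi> n \<epsilon> K) (hcat A B) = shrink n n Y"
    using terms_map.realization_linear_mnn[OF ext H]
      terms_map.realization_linear_mnn[OF terms_map_shrink[OF nm] Y]
    by (simp add: strassen_def sparse_concat_def realization_append ext_mnn_eq shr_mnn_eq
        X_def Y_def m_def k_def)
  have "\<bar>(shrink n n Y - A * B) $$ (i, j)\<bar> \<le> \<epsilon>" if ij: "i < n" "j < n" for i j
  proof -
    have "\<bar>Y $$ (i, j) - (\<Sum>l<m. X $$ (i, l) * X $$ (l, m + j))\<bar> \<le> \<epsilon>"
      unfolding Y_def m_def
      using ij nm X X_bound by (intro strassen_pow2_accuracy[OF family pos]) (auto simp: m_def)
    \<comment> \<open>For l from n on, both the entry of the padded first factor and that of the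
      second are padding.\<close>
    also have "(\<Sum>l<m. X $$ (i, l) * X $$ (l, m + j))
        = (\<Sum>l<m. if l \<in> {..<n} then A $$ (i, l) * B $$ (l, j) else 0)"
      using ij nm by (intro sum.cong refl) (auto simp: X_left X_right)
    also have "\<dots> = (\<Sum>l<n. A $$ (i, l) * B $$ (l, j))"
      using nm by (simp add: sum.If_cases Int_absorb1 flip: lessThan_def)
    also have "\<dots> = (A * B) $$ (i, j)"
      using A B ij by (simp add: scalar_prod_def atLeast0LessThan)
    finally show ?thesis using A B ij by (simp add: shrink_def)
  qed
  moreover have "shrink n n Y - A * B \<in> carrier_mat n n"
    using A B by (intro minus_carrier_mat mult_carrier_mat)
  ultimately show ?thesis
    unfolding R using n by (subst max_abs_le_iff) auto
qed

text \<open>Passes from the parameters at which the recursion stops to those in the final bounds: 2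
  ^ k <= 2 * n gives 4 ^ k <= 4 * n ^ 2, so the accuracy is tightened and the domain
  enlarged.\<close>

lemma monotone_cost_ceil_log2:
  assumes mono: "monotone_cost c \<Psi>" and n: "1 \<le> n" and pos: "0 < \<epsilon>" "0 < K"
  shows "c (\<Psi> (\<epsilon> / 4 ^ ceil_log2 n) (2 ^ ceil_log2 n * K))
    \<le> c (\<Psi> (\<epsilon> / (4 * real n ^ 2)) (2 * real n * K))"
proof -
  let ?k = "ceil_log2 n"
  have k: "2 ^ ?k \<le> 2 * real n"
    using of_nat_mono[OF ceil_log2_bounds(2)[OF n], where 'a = real]
    by (simp only: of_nat_power of_nat_mult of_nat_numeral)
  have "(4::real) ^ ?k = (2 ^ ?k)\<^sup>2"
    by (simp add: power2_eq_square flip: power_mult_distrib)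
  also have "\<dots> \<le> (2 * real n)\<^sup>2"
    using k by (intro power_mono) auto
  finally have "\<epsilon> / (4 * real n ^ 2) \<le> \<epsilon> / 4 ^ ?k"
    using pos n by (intro divide_left_mono) (auto simp: power_mult_distrib)
  moreover have "2 ^ ?k * K \<le> 2 * real n * K"
    using k pos by simp
  ultimately show ?thesis
    using mono pos n unfolding monotone_cost_def by simp
qed

lemma num_weights_strassen:
  assumes family: "product_family \<rho> \<Psi>" and n: "1 \<le> n" and pos: "0 < \<epsilon>" "0 < K"
    and mono: "monotone_cost num_weights \<Psi>"
  shows "real (num_weights (strassen \<Psi> n \<epsilon> K))
    \<le> 7 * real n powr log 2 7
        * (real (num_weights (\<Psi> (\<epsilon> / (4 * real n ^ 2)) (2 * real n * K))) + 12) - 9 * real n ^ 2"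
proof -
  define k where "k = ceil_log2 n"
  note b = ceil_log2_bounds[OF n, folded k_def]
  define W where "W = num_weights (\<Psi> (\<epsilon> / 4 ^ k) (2 ^ k * K))"
  define M where "M = num_weights (\<Psi> (\<epsilon> / (4 * real n ^ 2)) (2 * real n * K))"
  have b1: "real n \<le> 2 ^ k" and b2: "2 ^ k \<le> 2 * real n"
    using of_nat_mono[OF b(1), where 'a = real] of_nat_mono[OF b(2), where 'a = real]
    by (simp_all only: of_nat_power of_nat_mult of_nat_numeral)
  have four: "(4::real) ^ k = (2 ^ k)\<^sup>2"
    by (simp add: power2_eq_square flip: power_mult_distrib)
  have "W \<le> M"
    unfolding W_def M_def k_def by (rule monotone_cost_ceil_log2[OF mono n pos])
  \<comment> \<open>Exchanging the exponents turns 7 ^ k into a power of 2 ^ k, where 2 ^ k <= 2 * n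
    can be inserted; the rounding factor 2 then becomes 2 powr log 2 7 = 7.\<close>
  have "(7::real) ^ k = (2 powr log 2 7) powr real k"
    by (simp add: powr_realpow)
  also have "\<dots> = (2 powr real k) powr log 2 7"
    by (simp only: powr_powr mult.commute)
  also have "\<dots> \<le> (2 * real n) powr log 2 7"
    using b2 by (intro powr_mono2) (auto simp: powr_realpow)
  also have "\<dots> = 7 * real n powr log 2 7"
    by (simp add: powr_mult)
  finally have seven: "(7::real) ^ k \<le> 7 * real n powr log 2 7" .
  have "num_weights (ext_mnn n) \<le> 2 * n\<^sup>2"
    using order_trans[OF terms_map.num_weights_linear_mnn[OF terms_map_ext[OF b(1)]]
        sum_length_ext_terms[OF b(1)]]
    by (simp add: ext_mnn_eq k_def)
  moreover have "num_weights (shr_mnn n) \<le> n\<^sup>2"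
    using terms_map.num_weights_linear_mnn[OF terms_map_shrink[OF b(1)]]
    by (simp add: shr_mnn_eq k_def power2_eq_square)
  moreover have "num_weights (strassen_pow2 \<Psi> k \<epsilon> K) + 12 * 4 ^ k \<le> 7 ^ k * (W + 12)"
    unfolding W_def by (rule num_weights_strassen_pow2[OF family pos])
  ultimately have "num_weights (strassen \<Psi> n \<epsilon> K) + 12 * 4 ^ k \<le> 7 ^ k * (W + 12) + 3 * n\<^sup>2"
    by (simp add: strassen_def sparse_concat_def num_weights_append k_def)
  then have "real (num_weights (strassen \<Psi> n \<epsilon> K) + 12 * 4 ^ k) \<le> real (7 ^ k * (W + 12) + 3 * n\<^sup>2)"
    by (simp only: of_nat_le_iff)
  then have "real (num_weights (strassen \<Psi> n \<epsilon> K)) \<le> 7 ^ k * (real W + 12) + 3 * (real n)\<^sup>2 - 12 * 4 ^ k"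
    by simp
  \<comment> \<open>By n ^ 2 <= 4 ^ k, the surplus 12 * 4 ^ k covers the 3 * n ^ 2 weights of the
    two outer layers and leaves 9 * n ^ 2.\<close>
  also have "\<dots> \<le> 7 ^ k * (real W + 12) - 9 * (real n)\<^sup>2"
    using power_mono[OF b1, of 2] by (simp add: four)
  also have "\<dots> \<le> 7 * real n powr log 2 7 * (real M + 12) - 9 * (real n)\<^sup>2"
    using seven \<open>W \<le> M\<close> by (intro diff_right_mono mult_mono) auto
  finally show ?thesis unfolding M_def .
qed

text \<open>The outer layers contribute 2, and the 2 * k layers of the recursion at most 2 * log 2 n
  + 2, since rounding up costs less than 1.\<close>

lemma num_layers_strassen:
  assumes n: "1 \<le> n" and pos: "0 < \<epsilon>" "0 < K" and mono: "monotone_cost num_layers \<Psi>"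
  shows "real (num_layers (strassen \<Psi> n \<epsilon> K))
    \<le> real (num_layers (\<Psi> (\<epsilon> / (4 * real n ^ 2)) (2 * real n * K))) + 2 * (log 2 (real n) + 2)"
proof -
  have "num_layers (strassen \<Psi> n \<epsilon> K) = num_layers (strassen_pow2 \<Psi> (ceil_log2 n) \<epsilon> K) + 2"
    by (simp add: strassen_def sparse_concat_def num_layers_def ext_mnn_eq shr_mnn_eq linear_mnn_def)
  with monotone_cost_ceil_log2[OF mono n pos] ceil_log2_bounds(3)[OF n] show ?thesis
    by (simp add: num_layers_strassen_pow2)
qed

theorem corollary3p5:
  fixes \<rho> :: "real \<Rightarrow> real"
    and \<Psi> :: "real \<Rightarrow> real \<Rightarrow> mnn"
    and n :: nat
    and A B :: "real mat"
    and K \<epsilon> :: real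
  assumes "product_hypothesis \<rho>"
    and "product_family \<rho> \<Psi>"
    and "n \<ge> 1"
    and "A \<in> carrier_mat n n"
    and "B \<in> carrier_mat n n"
    and "K > 0"
    and "max_abs A \<le> K"
    and "max_abs B \<le> K"
    and "\<epsilon> > 0"
  shows "is_mnn \<rho> (n, 2 * n) (n, n) (strassen \<Psi> n \<epsilon> K) \<and>
    max_abs (realization (strassen \<Psi> n \<epsilon> K) (hcat A B) - A * B) \<le> \<epsilon> \<and>
    (monotone_cost num_weights \<Psi> \<longrightarrow>
       real (num_weights (strassen \<Psi> n \<epsilon> K))
         \<le> 7 * real n powr log 2 7
             * (real (num_weights (\<Psi> (\<epsilon> / (4 * real n ^ 2)) (2 * real n * K))) + 12)
           - 9 * real n ^ 2) \<and>
    (monotone_cost num_layers \<Psi> \<longrightarrow>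
       real (num_layers (strassen \<Psi> n \<epsilon> K))
         \<le> real (num_layers (\<Psi> (\<epsilon> / (4 * real n ^ 2)) (2 * real n * K)))
           + 2 * (log 2 (real n) + 2))"
  using is_mnn_strassen[OF assms(2,3,9,6)] strassen_accuracy[OF assms(2,3,9,6,4,5,7,8)]
    num_weights_strassen[OF assms(2,3,9,6)] num_layers_strassen[OF assms(3,9,6)] by blast

end
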